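(* Let $d\in\mathbb N$, let $p$ satisfy $1<p\le 4/3$, $p=2$, or $4\le p<\infty$, let $\mathcal S\subseteq\mathcal M_d$ be bounded with respect to the Schatten $p$-norm, and let $A\in\operatorname{conv}(\mathcal S)$. Then there exists a sequence $(X_i)_{i\ge1}\subseteq\mathcal S$ such that, with $A_k=\frac1k\sum_{i=1}^k X_i$, for every $k\ge1$: (a) if $1<p\le4/3$: $\displaystyle \|A-A_k\|_p\le \frac{2e^2}{p^{1/p}}\,k^{1/p-1}\,\operatorname{diam}(\mathcal S)$; (b) if $p=2$ or $4\le p<\infty$: $\displaystyle \|A-A_k\|_p\le e^2\sqrt{\frac{2(p-1)}{k}}\,\operatorname{diam}(\mathcal S)$.
   Context: $\mathcal M_d$ denotes the complex $d\times d$ matrices with the (unnormalised) Schatten $p$-norm $\|A\|_p=(\sum_i s_i(A)^p)^{1/p}$, $s_i(A)$ the singular values. $\operatorname{diam}(\mathcal S)=\sup\{\|X-Y\|_p: X,Y\in\mathcal S\}$. *)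

theory Defs
  imports "Jordan_Normal_Form.Schur_Decomposition" "HOL-Computational_Algebra.Fundamental_Theorem_Algebra"
begin

definition singular_values :: "complex mat \<Rightarrow> real multiset" where
  "singular_values A = image_mset (\<lambda>z. sqrt (Re z)) (proots (char_poly (mat_adjoint A * A)))"

definition schatten_norm :: "real \<Rightarrow> complex mat \<Rightarrow> real" where
  "schatten_norm p A = (\<Sum>s\<in>#singular_values A. s powr p) powr (1 / p)"

definition mat_conv :: "nat \<Rightarrow> complex mat set \<Rightarrow> complex mat set" where
  "mat_conv d S = {A. \<exists>(n::nat) (X::nat \<Rightarrow> complex mat) (w::nat \<Rightarrow> real).
      (\<forall>i<n. X i \<in> S \<and> 0 \<le> w i) \<and> (\<Sum>i<n. w i) = 1 \<and>
      A = mat d d (\<lambda>(r, c). \<Sum>i<n. complex_of_real (w i) * (X i $$ (r, c)))}"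

definition schatten_diam :: "real \<Rightarrow> complex mat set \<Rightarrow> real" where
  "schatten_diam p S = Sup {schatten_norm p (X - Y) | X Y. X \<in> S \<and> Y \<in> S}"

definition mat_avg :: "nat \<Rightarrow> (nat \<Rightarrow> complex mat) \<Rightarrow> nat \<Rightarrow> complex mat" where
  "mat_avg d X k = mat d d (\<lambda>(r, c). (1 / of_nat k) * (\<Sum>i\<in>{1..k}. X i $$ (r, c)))"

end

theory Submission
  imports Defs "HOL-Analysis.Convex"
begin

text \<open>
  The sequence is chosen greedily. Write \<open>E\<close> for the accumulated error \<open>\<Sum>(X\<^sub>i - A)\<close>. Since \<open>\<parallel>\<cdot>\<parallel>\<^sub>p\<^sup>p\<close> is
  convex and the vectors \<open>Y = X - A\<close> average to \<open>0\<close>, some \<open>Y\<close> increases \<open>\<parallel>E\<parallel>\<^sub>p\<^sup>p\<close> by at most a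
  bound for the symmetric second difference \<open>\<parallel>E + Y\<parallel>\<^sub>p\<^sup>p + \<parallel>E - Y\<parallel>\<^sub>p\<^sup>p - 2 \<parallel>E\<parallel>\<^sub>p\<^sup>p\<close>.

  For \<open>p \<le> 2\<close> this difference is at most \<open>2 \<parallel>Y\<parallel>\<^sub>p\<^sup>p\<close> (Clarkson's inequality): evaluate the columns of
  \<open>E \<plusminus> Y\<close> in an eigenbasis of \<open>E\<^sup>*E + Y\<^sup>*Y\<close>, use the parallelogram law and concavity of
  \<open>t\<^sup>p\<^sup>/\<^sup>2\<close>, and then the trace subadditivity of \<open>t\<^sup>p\<^sup>/\<^sup>2\<close>.

  For \<open>p \<ge> 2\<close> put \<open>M = E + Y\<close>, \<open>N = E - Y\<close>. The tangent inequality for \<open>\<parallel>\<cdot>\<parallel>\<^sub>p\<^sup>p\<close> at \<open>M\<close> and at \<open>N\<close> bounds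
  the difference by a double sum over singular values \<open>m\<^sub>i\<close> of \<open>M\<close> and \<open>n\<^sub>j\<close> of \<open>N\<close> of
  \<open>(m\<^sup>p\<^sup>-\<^sup>1 \<mp> n\<^sup>p\<^sup>-\<^sup>1)(m \<mp> n)\<close> with nonnegative weights. Replacing it by
  \<open>(p - 1)(m\<^sup>p\<^sup>-\<^sup>2 + n\<^sup>p\<^sup>-\<^sup>2)(m \<mp> n)\<^sup>2\<close> the sum collapses to weighted column norms of \<open>M - N\<close>, which Holder's
  inequality controls. So \<open>\<parallel>E\<parallel>\<^sup>p\<close> grows by at most \<open>4 p (p - 1) (\<parallel>E\<parallel> + D)\<^sup>p\<^sup>-\<^sup>2 D\<^sup>2\<close> per step; together with
  the trivial bound \<open>\<parallel>E\<parallel> \<le> k D\<close> for \<open>k\<close> up to a multiple of \<open>p\<close> this yields the square-root rate.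
\<close>

section \<open>Inequalities for real powers\<close>

text \<open>Young's inequality with exponents \<open>q\<close> and \<open>q / (q - 1)\<close>,
  applied to \<open>x\<close> and \<open>m powr (q - 1)\<close>, is the tangent line bound. The
  convention \<open>0 powr 0 = 0\<close> makes the point \<open>m = 0\<close> trivial.\<close>

lemma powr_ge_tangent:
  fixes x m q :: real
  assumes "q \<ge> 1" "x \<ge> 0" "m \<ge> 0"
  shows "m powr q + q * m powr (q - 1) * (x - m) \<le> x powr q"
proof (cases "q = 1 \<or> m = 0")
  case True
  then show ?thesis using assms by (cases "m = 0") auto
next
  case False
  with assms have q: "q > 1" and m: "m > 0" by auto
  have "x * m powr (q - 1) \<le> x powr q / q + (m powr (q - 1)) powr (q / (q - 1)) / (q / (q - 1))"
    by (rule Youngs_inequality) (use q assms in \<open>auto simp: field_simps\<close>)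
  also have "(m powr (q - 1)) powr (q / (q - 1)) = m powr q"
    using q by (simp add: powr_powr)
  finally have "q * (x * m powr (q - 1)) \<le> q * (x powr q / q + m powr q / (q / (q - 1)))"
    using q by (intro mult_left_mono) auto
  also have "\<dots> = x powr q + (q - 1) * m powr q"
    using q by (simp add: field_simps)
  finally have "q * (x * m powr (q - 1)) \<le> x powr q + (q - 1) * m powr q" .
  moreover have "m powr (q - 1) * m = m powr q"
    using m by (simp add: powr_diff)
  ultimately show ?thesis by (simp add: algebra_simps)
qed

lemma powr_minus_one_mult: "x \<ge> 0 \<Longrightarrow> x powr (q - 1) * x = x powr (q::real)"
  by (cases "x = 0") (auto simp: powr_diff)

text \<open>Jensen's inequality, by summing the tangent bound at the mean \<open>\<mu>\<close>.
  Total weight below 1 is allowed because the missing mass may be placed at 0, where the power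
  vanishes; \<open>svd_dominated_sum_le\<close> relies on this through the concave version.\<close>

lemma subconvex_sum_powr:
  fixes c s :: "'a \<Rightarrow> real"
  assumes "finite I" "q \<ge> 1" "\<And>k. k \<in> I \<Longrightarrow> 0 \<le> c k" "\<And>k. k \<in> I \<Longrightarrow> 0 \<le> s k" "sum c I \<le> 1"
  shows "(\<Sum>k\<in>I. c k * s k) powr q \<le> (\<Sum>k\<in>I. c k * s k powr q)"
proof -
  define \<mu> where "\<mu> = (\<Sum>k\<in>I. c k * s k)"
  have \<mu>: "\<mu> \<ge> 0" unfolding \<mu>_def using assms by (intro sum_nonneg) auto
  \<comment> \<open>The deficit \<open>1 - sum c I\<close> may carry the factor
    \<open>q >= 1\<close>; this is the form in which the right side is a sum of tangent
    values.\<close>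
  have "\<mu> powr q \<le> \<mu> powr q * (sum c I + q * (1 - sum c I))"
  proof -
    have "1 \<le> sum c I + q * (1 - sum c I)"
      using mult_right_mono[OF assms(2), of "1 - sum c I"] assms(5) by simp
    then show ?thesis by (simp add: mult_le_cancel_left1)
  qed
  also have "\<dots> = sum c I * \<mu> powr q + q * \<mu> powr (q - 1) * (\<mu> - sum c I * \<mu>)"
    using powr_minus_one_mult[OF \<mu>, of q] by (simp add: algebra_simps)
  also have "\<dots> = (\<Sum>k\<in>I. c k * (\<mu> powr q + q * \<mu> powr (q - 1) * (s k - \<mu>)))"
    by (simp add: \<mu>_def[symmetric] algebra_simps sum.distrib sum_subtractf flip: sum_distrib_left sum_distrib_right)
      (simp add: \<mu>_def sum_distrib_left sum_distrib_right algebra_simps)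
  also have "\<dots> \<le> (\<Sum>k\<in>I. c k * s k powr q)"
    using assms \<mu> by (intro sum_mono mult_left_mono powr_ge_tangent) auto
  finally show ?thesis unfolding \<mu>_def .
qed

text \<open>The convex case with exponent \<open>1 / r\<close>, applied to the values
  \<open>s k powr r\<close>.\<close>

lemma subconcave_sum_powr:
  fixes c s :: "'a \<Rightarrow> real"
  assumes "finite I" "0 < r" "r \<le> 1" "\<And>k. k \<in> I \<Longrightarrow> 0 \<le> c k" "\<And>k. k \<in> I \<Longrightarrow> 0 \<le> s k" "sum c I \<le> 1"
  shows "(\<Sum>k\<in>I. c k * s k powr r) \<le> (\<Sum>k\<in>I. c k * s k) powr r"
proof -
  have "(\<Sum>k\<in>I. c k * s k powr r) powr (1 / r) \<le> (\<Sum>k\<in>I. c k * (s k powr r) powr (1 / r))"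
    by (rule subconvex_sum_powr) (use assms in auto)
  also have "\<dots> = (\<Sum>k\<in>I. c k * s k)"
    using assms by (intro sum.cong) (auto simp: powr_powr)
  finally have "((\<Sum>k\<in>I. c k * s k powr r) powr (1 / r)) powr r \<le> (\<Sum>k\<in>I. c k * s k) powr r"
    using assms by (intro powr_mono2) auto
  moreover have "0 \<le> (\<Sum>k\<in>I. c k * s k powr r)" using assms by (intro sum_nonneg) auto
  ultimately show ?thesis using assms by (simp add: powr_powr)
qed

text \<open>Hoelder's inequality with exponents \<open>p / (p - 2)\<close> and \<open>p / 2\<close>,
  by summing Young's inequality after normalising by \<open>P\<close> and \<open>Z^2\<close>. Upper
  bounds on the power sums suffice as hypotheses, which is what \<open>svd_columns_le\<close>
  supplies for \<open>z\<close>.\<close>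

lemma Holder_sum_powr:
  fixes x z :: "'a \<Rightarrow> real"
  assumes "finite I" "p \<ge> 2" "P \<ge> 0" "Z \<ge> 0"
    and "\<And>i. i \<in> I \<Longrightarrow> 0 \<le> x i" "\<And>i. i \<in> I \<Longrightarrow> 0 \<le> z i"
    and X: "(\<Sum>i\<in>I. x i powr p) \<le> P powr p" and Z: "(\<Sum>i\<in>I. z i powr (p / 2)) \<le> Z powr p"
  shows "(\<Sum>i\<in>I. x i powr (p - 2) * z i) \<le> P powr (p - 2) * Z\<^sup>2"
proof -
  consider "P = 0" | "Z = 0" | "P > 0" "Z > 0" using assms by fastforce
  then show ?thesis
  proof cases
    case 1
    then have "(\<Sum>i\<in>I. x i powr p) = 0"
      using X by (intro antisym sum_nonneg) auto
    then have "\<forall>i\<in>I. x i = 0"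
      using assms(1) by (simp add: sum_nonneg_eq_0_iff)
    then show ?thesis using 1 by simp
  next
    case 2
    then have "(\<Sum>i\<in>I. z i powr (p/2)) = 0"
      using Z by (intro antisym sum_nonneg) auto
    then have "\<forall>i\<in>I. z i = 0"
      using assms(1) by (simp add: sum_nonneg_eq_0_iff)
    then show ?thesis using 2 by simp
  next
    case 3
    have Zsq: "(Z\<^sup>2) powr (p/2) = Z powr p"
      using 3 by (simp add: powr_powr flip: powr_numeral)
    have bound: "x i powr (p - 2) * z i \<le> P powr (p - 2) * Z\<^sup>2 *
        ((1 - 2/p) * (x i powr p / P powr p) + 2/p * (z i powr (p/2) / Z powr p))" if i: "i \<in> I" for i
    \<comment> \<open>The exponent \<open>p / (p - 2)\<close> degenerates at \<open>p = 2\<close>,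
      where the two sides differ only by the factor \<open>x i powr 0\<close>, which is 0 or
      1.\<close>
    proof (cases "p = 2")
      case True
      then show ?thesis using 3 assms i by (simp add: field_simps)
    next
      case False
      with assms have p: "p > 2" by auto
      have "(x i / P) powr (p - 2) * (z i / Z\<^sup>2) \<le>
          ((x i / P) powr (p - 2)) powr (p / (p - 2)) / (p / (p - 2)) + (z i / Z\<^sup>2) powr (p/2) / (p/2)"
        by (rule Youngs_inequality) (use p assms i in \<open>auto simp: field_simps\<close>)
      also have "((x i / P) powr (p - 2)) powr (p / (p - 2)) = x i powr p / P powr p"
        using p 3 assms i by (simp add: powr_powr powr_divide)
      also have "(z i / Z\<^sup>2) powr (p/2) = z i powr (p/2) / Z powr p"
        using 3 assms i by (simp add: powr_divide Zsq)
      finally have "P powr (p - 2) * Z\<^sup>2 * ((x i / P) powr (p - 2) * (z i / Z\<^sup>2)) \<le> P powr (p - 2) * Z\<^sup>2 *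
        (x i powr p / P powr p / (p / (p - 2)) + z i powr (p/2) / Z powr p / (p/2))"
        by (intro mult_left_mono) auto
      moreover have "P powr (p - 2) * Z\<^sup>2 * ((x i / P) powr (p - 2) * (z i / Z\<^sup>2)) = x i powr (p - 2) * z i"
        using 3 assms i by (simp add: powr_divide)
      moreover have "x i powr p / P powr p / (p / (p - 2)) = (1 - 2/p) * (x i powr p / P powr p)"
        using p by (simp add: field_simps)
      moreover have "z i powr (p/2) / Z powr p / (p/2) = 2/p * (z i powr (p/2) / Z powr p)"
        by (simp add: mult.commute)
      ultimately show ?thesis by (simp only:)
    qed
    have "(\<Sum>i\<in>I. x i powr (p - 2) * z i) \<le> (\<Sum>i\<in>I. P powr (p - 2) * Z\<^sup>2 *
        ((1 - 2/p) * (x i powr p / P powr p) + 2/p * (z i powr (p/2) / Z powr p)))"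
      by (intro sum_mono bound)
    also have "\<dots> = P powr (p - 2) * Z\<^sup>2 * ((1 - 2/p) * ((\<Sum>i\<in>I. x i powr p) / P powr p)
        + 2/p * ((\<Sum>i\<in>I. z i powr (p/2)) / Z powr p))"
      by (simp add: sum.distrib flip: sum_distrib_left sum_divide_distrib)
    also have "\<dots> \<le> P powr (p - 2) * Z\<^sup>2 * ((1 - 2/p) * 1 + 2/p * 1)"
      using assms 3 by (intro mult_left_mono add_mono) (auto simp: field_simps)
    finally show ?thesis by simp
  qed
qed

text \<open>The tangent at the larger number gives the bound with one power; the other is added for
  symmetry. The factor \<open>m powr (p - 2) + n powr (p - 2)\<close> is shared with
  \<open>powr_add_mult_le\<close>, so that the two bounds can be combined with weights.\<close>

lemma powr_diff_mult_le:
  fixes m n p :: real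
  assumes "p \<ge> 2" "m \<ge> 0" "n \<ge> 0"
  shows "(m powr (p - 1) - n powr (p - 1)) * (m - n)
    \<le> (p - 1) * ((m powr (p - 2) + n powr (p - 2)) * (m - n)\<^sup>2)"
proof -
  have *: "(m powr (p - 1) - n powr (p - 1)) * (m - n)
    \<le> (p - 1) * ((m powr (p - 2) + n powr (p - 2)) * (m - n)\<^sup>2)" if "n \<le> m" "m \<ge> 0" "n \<ge> 0" for m n :: real
  proof -
    have "m powr (p - 1) - n powr (p - 1) \<le> (p - 1) * m powr (p - 2) * (m - n)"
      using powr_ge_tangent[of "p - 1" n m] that assms by (simp add: algebra_simps)
    then have "(m powr (p - 1) - n powr (p - 1)) * (m - n) \<le> (p - 1) * m powr (p - 2) * (m - n) * (m - n)"
      using that by (intro mult_right_mono) auto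
    also have "\<dots> \<le> (p - 1) * ((m powr (p - 2) + n powr (p - 2)) * (m - n)\<^sup>2)"
      using assms by (simp add: power2_eq_square mult.assoc mult_left_mono mult_right_mono)
    finally show ?thesis .
  qed
  show ?thesis
  proof (cases "n \<le> m")
    case False
    then show ?thesis using *[of m n] assms by (simp add: algebra_simps power2_commute)
  qed (use * assms in auto)
qed

text \<open>Adding the mixed products already gives the bound with constant 1; the factor
  \<open>p - 1 >= 1\<close> is inserted to match \<open>powr_diff_mult_le\<close>.\<close>

lemma powr_add_mult_le:
  fixes m n p :: real
  assumes "p \<ge> 2" "m \<ge> 0" "n \<ge> 0"
  shows "(m powr (p - 1) + n powr (p - 1)) * (m + n)
    \<le> (p - 1) * ((m powr (p - 2) + n powr (p - 2)) * (m + n)\<^sup>2)"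
proof -
  have e: "m powr (p - 1) = m powr (p - 2) * m" "n powr (p - 1) = n powr (p - 2) * n"
    using powr_minus_one_mult[of m "p - 1"] powr_minus_one_mult[of n "p - 1"] assms by auto
  have "m powr (p - 1) + n powr (p - 1) \<le> (m powr (p - 2) + n powr (p - 2)) * (m + n)"
    using assms by (simp add: e algebra_simps)
  then have "(m powr (p - 1) + n powr (p - 1)) * (m + n) \<le> (m powr (p - 2) + n powr (p - 2)) * (m + n) * (m + n)"
    using assms by (intro mult_right_mono) auto
  also have "\<dots> = 1 * ((m powr (p - 2) + n powr (p - 2)) * (m + n)\<^sup>2)"
    by (simp add: power2_eq_square mult.assoc)
  also have "\<dots> \<le> (p - 1) * ((m powr (p - 2) + n powr (p - 2)) * (m + n)\<^sup>2)"
    using assms by (intro mult_right_mono) auto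
  finally show ?thesis .
qed

section \<open>Orthonormal bases and the spectral theorem\<close>

text \<open>Vectors and matrices are functions on the naturals of which only the values at indices
  below \<open>d\<close> matter, so no carrier conditions arise.\<close>

definition cinner :: "nat \<Rightarrow> (nat \<Rightarrow> complex) \<Rightarrow> (nat \<Rightarrow> complex) \<Rightarrow> complex" where
  "cinner d x y = (\<Sum>r<d. cnj (x r) * y r)"

definition sqnorm :: "nat \<Rightarrow> (nat \<Rightarrow> complex) \<Rightarrow> real" where
  "sqnorm d x = (\<Sum>r<d. (cmod (x r))\<^sup>2)"

definition onb :: "nat \<Rightarrow> (nat \<Rightarrow> nat \<Rightarrow> complex) \<Rightarrow> bool" where
  "onb d u \<longleftrightarrow> (\<forall>i<d. \<forall>j<d. cinner d (u i) (u j) = (if i = j then 1 else 0))"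

definition mvec :: "nat \<Rightarrow> (nat \<Rightarrow> nat \<Rightarrow> complex) \<Rightarrow> (nat \<Rightarrow> complex) \<Rightarrow> nat \<Rightarrow> complex" where
  "mvec d X x = (\<lambda>r. \<Sum>c<d. X r c * x c)"

definition adj :: "(nat \<Rightarrow> nat \<Rightarrow> complex) \<Rightarrow> nat \<Rightarrow> nat \<Rightarrow> complex" where
  "adj X = (\<lambda>r c. cnj (X c r))"

lemma cnj_cinner: "cnj (cinner d x y) = cinner d y x"
  by (simp add: cinner_def mult.commute)

lemma norm_cinner_commute: "cmod (cinner d x y) = cmod (cinner d y x)"
  by (metis cnj_cinner complex_mod_cnj)

lemma cinner_self: "cinner d x x = of_real (sqnorm d x)"
  unfolding cinner_def sqnorm_def of_real_sum
  by (intro sum.cong refl) (simp add: mult.commute complex_mult_cnj cmod_power2)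

lemma sqnorm_nonneg [simp]: "0 \<le> sqnorm d x"
  by (simp add: sqnorm_def sum_nonneg)

lemma sqnorm_eq_0_iff: "sqnorm d x = 0 \<longleftrightarrow> (\<forall>r<d. x r = 0)"
  by (auto simp: sqnorm_def sum_nonneg_eq_0_iff)

lemma cinner_cong: "(\<And>r. r < d \<Longrightarrow> x r = x' r) \<Longrightarrow> (\<And>r. r < d \<Longrightarrow> y r = y' r) \<Longrightarrow> cinner d x y = cinner d x' y'"
  by (simp add: cinner_def)

lemma cinner_sum_right: "cinner d y (\<lambda>r. \<Sum>k\<in>K. g k * u k r) = (\<Sum>k\<in>K. g k * cinner d y (u k))"
  unfolding cinner_def sum_distrib_left by (subst sum.swap) (simp add: mult_ac)

lemma cinner_scale_right: "cinner d y (\<lambda>r. g * u r) = g * cinner d y u"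
  by (simp add: cinner_def sum_distrib_left mult_ac)

lemma cinner_scale_left: "cinner d (\<lambda>r. g * u r) y = cnj g * cinner d u y"
  by (simp add: cinner_def sum_distrib_left mult_ac)

lemma mvec_sum: "mvec d X (\<lambda>r. \<Sum>k\<in>K. g k * u k r) = (\<lambda>r. \<Sum>k\<in>K. g k * mvec d X (u k) r)"
  unfolding mvec_def sum_distrib_left by (subst sum.swap) (simp add: mult_ac)

lemma mvec_scale: "mvec d X (\<lambda>r. g * u r) = (\<lambda>r. g * mvec d X u r)"
  by (simp add: mvec_def sum_distrib_left mult_ac)

lemma cinner_mvec_adj: "cinner d y (mvec d X x) = cinner d (mvec d (adj X) y) x"
  unfolding cinner_def mvec_def adj_def cnj_sum sum_distrib_left sum_distrib_right
  by (subst sum.swap) (simp add: mult_ac)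

text \<open>One-sided inverses of square matrices are two-sided: orthonormality of \<open>d\<close>
  vectors is \<open>U * V = 1\<close>, completeness is \<open>V * U = 1\<close>.\<close>

lemma onb_complete:
  assumes "onb d u" "r < d" "t < d"
  shows "(\<Sum>k<d. u k r * cnj (u k t)) = (if r = t then 1 else 0)"
proof -
  define U where "U = mat d d (\<lambda>(k, r). cnj (u k r))"
  define V where "V = mat d d (\<lambda>(r, k). u k r)"
  have UV: "U \<in> carrier_mat d d" "V \<in> carrier_mat d d" by (auto simp: U_def V_def)
  have "U * V = 1\<^sub>m d"
    using assms(1) by (intro eq_matI)
      (auto simp: U_def V_def scalar_prod_def onb_def cinner_def atLeast0LessThan)
  then have "V * U = 1\<^sub>m d" by (rule mat_mult_left_right_inverse[OF UV])
  then have "(V * U) $$ (r, t) = 1\<^sub>m d $$ (r, t)" by simp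
  then show ?thesis using assms(2,3)
    by (auto simp: U_def V_def scalar_prod_def atLeast0LessThan)
qed

lemma onb_expand:
  assumes "onb d u" "r < d"
  shows "x r = (\<Sum>k<d. cinner d (u k) x * u k r)"
proof -
  have "(\<Sum>k<d. cinner d (u k) x * u k r) = (\<Sum>t<d. (\<Sum>k<d. u k r * cnj (u k t)) * x t)"
    unfolding cinner_def sum_distrib_right by (subst sum.swap) (simp add: mult_ac)
  also have "\<dots> = (\<Sum>t<d. (if r = t then 1 else 0) * x t)"
    using assms by (intro sum.cong refl) (simp add: onb_complete)
  also have "\<dots> = x r" using assms(2) by (simp add: if_distrib[of "\<lambda>z. z * _"] cong: if_cong)
  finally show ?thesis by simp
qed

lemma cinner_parseval:
  assumes "onb d u"
  shows "cinner d x y = (\<Sum>k<d. cinner d x (u k) * cinner d (u k) y)"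
proof -
  have "cinner d x y = cinner d x (\<lambda>r. \<Sum>k<d. cinner d (u k) y * u k r)"
    by (rule cinner_cong) (use onb_expand[OF assms] in auto)
  then show ?thesis unfolding cinner_sum_right by (simp only: mult.commute)
qed

lemma sqnorm_parseval:
  assumes "onb d u"
  shows "sqnorm d x = (\<Sum>k<d. (cmod (cinner d (u k) x))\<^sup>2)"
proof -
  have "complex_of_real (sqnorm d x) = (\<Sum>k<d. cinner d x (u k) * cinner d (u k) x)"
    using cinner_parseval[OF assms, of x x] by (simp add: cinner_self)
  also have "\<dots> = of_real (\<Sum>k<d. (cmod (cinner d (u k) x))\<^sup>2)"
    unfolding of_real_sum
    by (intro sum.cong refl, subst cnj_cinner[symmetric]) (metis complex_norm_square mult.commute of_real_power)
  finally show ?thesis by (simp only: of_real_eq_iff)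
qed

lemma onb_sqnorm: "onb d u \<Longrightarrow> k < d \<Longrightarrow> sqnorm d (u k) = 1"
  using cinner_self[of d "u k"] of_real_eq_1_iff[of "sqnorm d (u k)"] by (simp add: onb_def)

lemma onb_sum_left:
  assumes "onb d u" "onb d v" "j < d"
  shows "(\<Sum>i<d. (cmod (cinner d (u i) (v j)))\<^sup>2) = 1"
  using sqnorm_parseval[OF assms(1), of "v j"] onb_sqnorm[OF assms(2,3)] by simp

lemma onb_sum_right:
  assumes "onb d u" "onb d v" "i < d"
  shows "(\<Sum>j<d. (cmod (cinner d (u i) (v j)))\<^sup>2) = 1"
  using onb_sum_left[OF assms(2,1,3)] by (simp add: norm_cinner_commute)

lemma ex_unit_multiple:
  assumes "\<exists>r<d. w r \<noteq> 0"
  shows "\<exists>g. g \<noteq> 0 \<and> cinner d (\<lambda>r. g * w r) (\<lambda>r. g * w r) = 1"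
proof -
  have "sqnorm d w \<noteq> 0" using assms by (auto simp: sqnorm_eq_0_iff)
  then have pos: "sqnorm d w > 0" using sqnorm_nonneg[of d w] by linarith
  define g where "g = complex_of_real (1 / sqrt (sqnorm d w))"
  have "cnj g * g * of_real (sqnorm d w) = of_real (1 / sqrt (sqnorm d w) * (1 / sqrt (sqnorm d w)) * sqnorm d w)"
    by (simp only: g_def of_real_mult complex_cnj_complex_of_real)
  also have "\<dots> = 1" using pos by (simp add: field_simps)
  finally have "cinner d (\<lambda>r. g * w r) (\<lambda>r. g * w r) = 1"
    by (simp only: cinner_scale_left cinner_scale_right cinner_self mult_ac)
  moreover have "g \<noteq> 0" using pos by (simp add: g_def)
  ultimately show ?thesis by blast
qed

text \<open>Induction on the number of free indices. The matrix whose rows are the conjugates of the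
  fixed vectors, with a zero row at a free index \<open>t\<close>, is singular; a kernel vector is
  orthogonal to all fixed vectors and, normalised, fills the slot \<open>t\<close>.\<close>

lemma orthonormal_extend:
  assumes "I \<subseteq> {..<d}" "\<And>i j. i \<in> I \<Longrightarrow> j \<in> I \<Longrightarrow> cinner d (v i) (v j) = (if i = j then 1 else 0)"
  shows "\<exists>u. onb d u \<and> (\<forall>i\<in>I. u i = v i)"
  using assms
proof (induction "card ({..<d} - I)" arbitrary: I v)
  case 0
  then have "I = {..<d}" by auto
  then show ?case using 0 by (intro exI[of _ v]) (auto simp: onb_def)
next
  case (Suc n)
  then obtain t where t: "t < d" "t \<notin> I"
    by (metis card.empty Diff_eq_empty_iff lessThan_iff nat.distinct(1) subsetI)
  define c where "c = (\<lambda>k. vec d (\<lambda>r. if k \<in> I then cnj (v k r) else 0))"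
  define B where "B = mat\<^sub>r d d (\<lambda>i. if i = t then 0\<^sub>v d else c i)"
  have B: "B \<in> carrier_mat d d" by (simp add: B_def)
  have "det B = 0" unfolding B_def by (rule det_row_0) (use t in \<open>auto simp: c_def\<close>)
  then obtain w where w: "w \<in> carrier_vec d" "w \<noteq> 0\<^sub>v d" "B *\<^sub>v w = 0\<^sub>v d"
    using det_0_iff_vec_prod_zero_field[OF B] by auto
  have orth: "cinner d (v i) (\<lambda>r. w $ r) = 0" if "i \<in> I" for i
  proof -
    have i: "i < d" "i \<noteq> t" using that Suc.prems t by auto
    have "(B *\<^sub>v w) $ i = 0" using i w by simp
    then show ?thesis using i that w(1)
      by (simp add: B_def c_def scalar_prod_def cinner_def atLeast0LessThan)
  qed
  have "\<exists>r<d. w $ r \<noteq> 0" using w by (metis eq_vecI carrier_vecD index_zero_vec)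
  then obtain g where g: "cinner d (\<lambda>r. g * w $ r) (\<lambda>r. g * w $ r) = 1"
    using ex_unit_multiple by blast
  define v' where "v' = v(t := (\<lambda>r. g * w $ r))"
  have orth': "cinner d (\<lambda>r. g * w $ r) (v i) = 0" if "i \<in> I" for i
    using orth[OF that] by (simp add: cinner_scale_left) (metis cnj_cinner complex_cnj_zero)
  have "\<exists>u. onb d u \<and> (\<forall>i\<in>insert t I. u i = v' i)"
  proof (rule Suc.hyps(1))
    have "{..<d} - I = insert t ({..<d} - insert t I)" using t by auto
    then have "card ({..<d} - I) = Suc (card ({..<d} - insert t I))"
      by (metis Diff_iff card_insert_disjoint finite_Diff finite_lessThan insertI1)
    then show "n = card ({..<d} - insert t I)" using Suc.hyps(2) by simp
    show "insert t I \<subseteq> {..<d}" using t Suc.prems by auto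
    show "cinner d (v' i) (v' j) = (if i = j then 1 else 0)" if "i \<in> insert t I" "j \<in> insert t I" for i j
      using that t(2) g orth orth' Suc.prems(2) by (auto simp: v'_def cinner_scale_right)
  qed
  then show ?case using t by (auto simp: v'_def)
qed

text \<open>Induction on the dimension: a root of the characteristic polynomial supplies one
  eigenvector, which becomes the first vector of an orthonormal basis \<open>e\<close>, and the
  induction hypothesis diagonalises \<open>G\<close> on the orthogonal complement.\<close>

lemma hermitian_spectral:
  assumes "\<And>r c. r < d \<Longrightarrow> c < d \<Longrightarrow> G r c = cnj (G c r)"
  shows "\<exists>u (l :: nat \<Rightarrow> real). onb d u \<and> (\<forall>k<d. \<forall>r<d. mvec d G (u k) r = of_real (l k) * u k r)"
  using assms
proof (induction d arbitrary: G)
  case 0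
  then show ?case by (simp add: onb_def)
next
  case (Suc d)
  let ?n = "Suc d"
  have selfadj: "cinner ?n y (mvec ?n G x) = cinner ?n (mvec ?n G y) x" for x y
  proof -
    have "mvec ?n (adj G) y r = mvec ?n G y r" if "r < ?n" for r
      unfolding mvec_def adj_def by (rule sum.cong) (metis Suc.prems lessThan_iff that)+
    then show ?thesis unfolding cinner_mvec_adj by (intro cinner_cong) auto
  qed
  define M where "M = mat ?n ?n (\<lambda>(r, c). G r c)"
  have M: "M \<in> carrier_mat ?n ?n" by (simp add: M_def)
  have "degree (char_poly M) = ?n" using degree_monic_char_poly[OF M] by simp
  then obtain \<mu> where "poly (char_poly M) \<mu> = 0"
    using fundamental_theorem_of_algebra[of "char_poly M"] by (auto simp: constant_degree)
  then obtain w where w: "w \<in> carrier_vec ?n" "w \<noteq> 0\<^sub>v ?n" "M *\<^sub>v w = \<mu> \<cdot>\<^sub>v w"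
    using eigenvalue_root_char_poly[OF M] M unfolding eigenvalue_def eigenvector_def by auto
  have Gw: "mvec ?n G (\<lambda>r. w $ r) r = \<mu> * w $ r" if "r < ?n" for r
  proof -
    have "(M *\<^sub>v w) $ r = \<mu> * w $ r" using w that by simp
    then show ?thesis using w(1) that
      by (simp add: M_def scalar_prod_def mvec_def atLeast0LessThan del: sum.lessThan_Suc sum.op_ivl_Suc)
  qed
  have "\<exists>r<?n. w $ r \<noteq> 0" using w by (metis eq_vecI carrier_vecD index_zero_vec)
  then obtain g where g: "cinner ?n (\<lambda>r. g * w $ r) (\<lambda>r. g * w $ r) = 1"
    using ex_unit_multiple by blast
  obtain e where e: "onb ?n e" "e 0 = (\<lambda>r. g * w $ r)"
    using orthonormal_extend[of "{0}" ?n "\<lambda>_ r. g * w $ r"] g by auto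
  have Ge: "mvec ?n G (e 0) r = \<mu> * e 0 r" if "r < ?n" for r
    using Gw[OF that] by (simp add: e mvec_scale)
  have ee: "cinner ?n (e i) (e j) = (if i = j then 1 else 0)" if "i < ?n" "j < ?n" for i j
    using e(1) that by (auto simp: onb_def)
  have "cinner ?n (e 0) (mvec ?n G (e 0)) = cinner ?n (e 0) (\<lambda>r. \<mu> * e 0 r)"
    using Ge by (intro cinner_cong) auto
  moreover have "cinner ?n (mvec ?n G (e 0)) (e 0) = cinner ?n (\<lambda>r. \<mu> * e 0 r) (e 0)"
    using Ge by (intro cinner_cong) auto
  ultimately have "cnj \<mu> = \<mu>" using selfadj[of "e 0" "e 0"] ee[of 0 0]
    by (simp add: cinner_scale_left cinner_scale_right)
  then have \<mu>: "\<mu> = of_real (Re \<mu>)" by (metis Reals_cnj_iff of_real_Re)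
  \<comment> \<open>The compression of \<open>G\<close> to the span of the \<open>e (Suc i)\<close>,
    written in that basis.\<close>
  define G' where "G' = (\<lambda>i j. cinner ?n (e (Suc i)) (mvec ?n G (e (Suc j))))"
  have "\<exists>x (l :: nat \<Rightarrow> real). onb d x \<and> (\<forall>k<d. \<forall>r<d. mvec d G' (x k) r = of_real (l k) * x k r)"
    by (rule Suc.IH) (simp add: G'_def selfadj cnj_cinner)
  then obtain x and l :: "nat \<Rightarrow> real" where x: "onb d x"
    and l: "\<And>k r. k < d \<Longrightarrow> r < d \<Longrightarrow> mvec d G' (x k) r = of_real (l k) * x k r" by blast
  \<comment> \<open>Eigenvectors of the compression, read as coordinates with respect to the
    \<open>e (Suc i)\<close>.\<close>
  define y where "y = (\<lambda>k r. \<Sum>i<d. x k i * e (Suc i) r)"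
  define u where "u = (\<lambda>k. case k of 0 \<Rightarrow> e 0 | Suc k \<Rightarrow> y k)"
  define m where "m = (\<lambda>k. case k of 0 \<Rightarrow> Re \<mu> | Suc k \<Rightarrow> l k)"
  have ey: "cinner ?n (e (Suc j)) (y k) = x k j" if "j < d" for j k
  proof -
    have "cinner ?n (e (Suc j)) (y k) = (\<Sum>i<d. x k i * cinner ?n (e (Suc j)) (e (Suc i)))"
      unfolding y_def by (rule cinner_sum_right)
    also have "\<dots> = (\<Sum>i<d. x k i * (if j = i then 1 else 0))"
      by (intro sum.cong refl) (use that in \<open>simp add: ee\<close>)
    also have "\<dots> = x k j" using that by (simp add: if_distrib[of "\<lambda>z. _ * z"] cong: if_cong)
    finally show ?thesis .
  qed
  have e0y: "cinner ?n (e 0) (y k) = 0" for k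
    unfolding y_def cinner_sum_right by (simp add: ee)
  have ye0: "cinner ?n (y k) (e 0) = 0" for k
    using e0y[of k] by (metis cnj_cinner complex_cnj_zero)
  have yy: "cinner ?n (y k) (y j) = (if k = j then 1 else 0)" if "k < d" "j < d" for k j
  proof -
    have "cinner ?n (y k) (y j) = (\<Sum>i<?n. cinner ?n (y k) (e i) * cinner ?n (e i) (y j))"
      by (rule cinner_parseval[OF e(1)])
    also have "\<dots> = (\<Sum>i<d. cinner ?n (y k) (e (Suc i)) * cinner ?n (e (Suc i)) (y j))"
      by (simp only: sum.lessThan_Suc_shift e0y ye0) simp
    also have "\<dots> = (\<Sum>i<d. cnj (x k i) * x j i)"
      by (intro sum.cong refl) (simp add: ey, metis cnj_cinner ey)
    also have "\<dots> = cinner d (x k) (x j)" by (simp add: cinner_def)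
    finally show ?thesis using x that by (simp add: onb_def)
  qed
  have Gy: "mvec ?n G (y k) r = of_real (l k) * y k r" if "k < d" "r < ?n" for k r
  proof -
    \<comment> \<open>The complement of an eigenvector is invariant: self-adjointness moves
      \<open>G\<close> onto \<open>e 0\<close>, which is orthogonal to \<open>y k\<close>.\<close>
    have 1: "cinner ?n (e 0) (mvec ?n G (y k)) = 0"
    proof -
      have "cinner ?n (e 0) (mvec ?n G (y k)) = cinner ?n (\<lambda>r. \<mu> * e 0 r) (y k)"
        unfolding selfadj using Ge by (intro cinner_cong) auto
      then show ?thesis by (simp add: cinner_scale_left e0y)
    qed
    have 2: "cinner ?n (e (Suc i)) (mvec ?n G (y k)) = of_real (l k) * x k i" if "i < d" for i
    proof -
      have "cinner ?n (e (Suc i)) (mvec ?n G (y k)) = (\<Sum>j<d. x k j * G' i j)"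
        unfolding y_def mvec_sum cinner_sum_right G'_def ..
      also have "\<dots> = mvec d G' (x k) i" by (simp add: mvec_def mult.commute)
      finally show ?thesis using l[OF \<open>k < d\<close> that] by simp
    qed
    have "mvec ?n G (y k) r = (\<Sum>i<?n. cinner ?n (e i) (mvec ?n G (y k)) * e i r)"
      by (rule onb_expand[OF e(1) that(2)])
    also have "\<dots> = (\<Sum>i<d. of_real (l k) * x k i * e (Suc i) r)"
      by (simp only: sum.lessThan_Suc_shift 1) (simp add: 2)
    also have "\<dots> = of_real (l k) * y k r" by (simp add: y_def sum_distrib_left mult.assoc)
    finally show ?thesis .
  qed
  have "onb ?n u" unfolding onb_def
    using yy e0y ye0 ee by (auto simp: u_def split: nat.splits)
  moreover have "\<forall>k<?n. \<forall>r<?n. mvec ?n G (u k) r = of_real (m k) * u k r"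
    using Ge Gy \<mu> by (auto simp: u_def m_def split: nat.splits)
  ultimately show ?case by blast
qed

text \<open>The vectors \<open>a k\<close> are right and the \<open>b k\<close> left singular
  vectors. The values \<open>s k\<close> are unordered and may vanish, so that both families are
  full bases.\<close>

definition svd :: "nat \<Rightarrow> (nat \<Rightarrow> nat \<Rightarrow> complex) \<Rightarrow> (nat \<Rightarrow> nat \<Rightarrow> complex) \<Rightarrow> (nat \<Rightarrow> nat \<Rightarrow> complex)
    \<Rightarrow> (nat \<Rightarrow> real) \<Rightarrow> bool" where
  "svd d X a b s \<longleftrightarrow> onb d a \<and> onb d b \<and> (\<forall>k<d. 0 \<le> s k) \<and>
    (\<forall>r<d. \<forall>c<d. X r c = (\<Sum>k<d. of_real (s k) * b k r * cnj (a k c)))"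

section \<open>Singular value decompositions\<close>

lemma onb_expand_matrix:
  assumes "onb d a" "r < d" "c < d"
  shows "X r c = (\<Sum>k<d. mvec d X (a k) r * cnj (a k c))"
proof -
  have "(\<Sum>k<d. mvec d X (a k) r * cnj (a k c)) = (\<Sum>t<d. X r t * (\<Sum>k<d. a k t * cnj (a k c)))"
    unfolding mvec_def sum_distrib_right sum_distrib_left by (subst sum.swap) (simp add: mult_ac)
  also have "\<dots> = (\<Sum>t<d. X r t * (if t = c then 1 else 0))"
    using assms by (intro sum.cong refl) (simp add: onb_complete)
  also have "\<dots> = X r c" using assms(3) by (simp add: if_distrib[of "\<lambda>z. _ * z"] cong: if_cong)
  finally show ?thesis by simp
qed

lemma adj_adj [simp]: "adj (adj X) = X"
  by (simp add: adj_def)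

lemma cinner_mvec_gram:
  "cinner d y (mvec d (\<lambda>r c. \<Sum>t<d. cnj (X t r) * X t c) x) = cinner d (mvec d X y) (mvec d X x)"
proof -
  have "mvec d (\<lambda>r c. \<Sum>t<d. cnj (X t r) * X t c) x = mvec d (adj X) (mvec d X x)"
    unfolding mvec_def adj_def sum_distrib_right sum_distrib_left
    by (subst sum.swap) (simp add: mult_ac)
  then show ?thesis by (simp add: cinner_mvec_adj)
qed

text \<open>An eigenbasis makes \<open>M\<close> similar to a diagonal matrix. This ties the
  singular values, defined through a characteristic polynomial, to the spectral theorem.\<close>

lemma proots_char_poly_spectral:
  assumes M: "M \<in> carrier_mat d d" and u: "onb d u"
    and ev: "\<And>k r. k < d \<Longrightarrow> r < d \<Longrightarrow> mvec d (\<lambda>r c. M $$ (r, c)) (u k) r = l k * u k r"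
  shows "proots (char_poly M) = image_mset l (mset_set {..<d})"
proof -
  define U where "U = mat d d (\<lambda>(r, k). u k r)"
  define V where "V = mat d d (\<lambda>(k, r). cnj (u k r))"
  define L where "L = mat d d (\<lambda>(i, j). if i = j then l i else 0)"
  have carr: "U \<in> carrier_mat d d" "V \<in> carrier_mat d d" "L \<in> carrier_mat d d"
    by (auto simp: U_def V_def L_def)
  have VU: "V * U = 1\<^sub>m d"
    using u by (intro eq_matI)
      (auto simp: U_def V_def scalar_prod_def onb_def cinner_def atLeast0LessThan)
  then have UV: "U * V = 1\<^sub>m d" by (rule mat_mult_left_right_inverse[OF carr(2,1)])
  have UL: "U * L = mat d d (\<lambda>(r, k). l k * u k r)"
    by (intro eq_matI) (auto simp: U_def L_def scalar_prod_def atLeast0LessThan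
      if_distrib[of "\<lambda>z. _ * z"] mult.commute cong: if_cong)
  have "M = U * L * V"
  proof (intro eq_matI)
    fix r c assume "r < dim_row (U * L * V)" "c < dim_col (U * L * V)"
    then have rc: "r < d" "c < d" by (auto simp: U_def V_def)
    have "M $$ (r, c) = (\<Sum>k<d. mvec d (\<lambda>r c. M $$ (r, c)) (u k) r * cnj (u k c))"
      by (rule onb_expand_matrix[OF u rc])
    also have "\<dots> = (\<Sum>k<d. l k * u k r * cnj (u k c))"
      using rc by (intro sum.cong refl) (simp add: ev)
    also have "\<dots> = (U * L * V) $$ (r, c)"
      unfolding UL using rc by (simp add: V_def scalar_prod_def atLeast0LessThan)
    finally show "M $$ (r, c) = (U * L * V) $$ (r, c)" .
  qed (use M in \<open>auto simp: U_def V_def\<close>)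
  then have "similar_mat_wit M L U V"
    using M carr UV VU by (auto simp: similar_mat_wit_def Let_def)
  then have "char_poly M = char_poly L" by (intro char_poly_similar) (auto simp: similar_mat_def)
  also have "\<dots> = (\<Prod>a\<leftarrow>diag_mat L. [:- a, 1:])"
    by (rule char_poly_upper_triangular[OF carr(3)]) (auto simp: upper_triangular_def L_def)
  also have "diag_mat L = map l [0..<d]" by (auto simp: diag_mat_def L_def)
  finally have "char_poly M = prod_list (map (\<lambda>k. [:- l k, 1:]) [0..<d])" by (simp add: o_def)
  moreover have "0 \<notin> set (map (\<lambda>k. [:- l k, 1:]) [0..<d])" by auto
  ultimately have "proots (char_poly M) = sum_list (map proots (map (\<lambda>k. [:- l k, 1:]) [0..<d]))"
    using proots_prod_list[of "map (\<lambda>k. [:- l k, 1:]) [0..<d]"] by simp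
  also have "\<dots> = (\<Sum>k\<leftarrow>[0..<d]. {#l k#})" by (simp add: o_def)
  also have "\<dots> = image_mset l (mset [0..<d])" by (induction d) auto
  finally show ?thesis by (simp add: lessThan_atLeast0)
qed

text \<open>\<open>X\<close> maps an eigenbasis \<open>a\<close> of its Gram matrix \<open>G\<close>
  to orthogonal vectors of squared length \<open>l k\<close>. The nonzero ones are normalised and
  extended to the basis \<open>b\<close>.\<close>

lemma ex_svd_singular_values:
  "\<exists>a b s. svd d X a b s \<and> singular_values (mat d d (\<lambda>(r, c). X r c)) = image_mset s (mset_set {..<d})"
proof -
  define G where "G = (\<lambda>r c. \<Sum>t<d. cnj (X t r) * X t c)"
  obtain a l where a: "onb d a"
    and l: "\<And>k r. k < d \<Longrightarrow> r < d \<Longrightarrow> mvec d G (a k) r = complex_of_real (l k) * a k r"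
    using hermitian_spectral[of d G] by (auto simp: G_def mult.commute)
  have gram: "cinner d (mvec d X (a j)) (mvec d X (a k)) = (if j = k then of_real (l k) else 0)"
    if "j < d" "k < d" for j k
  proof -
    have "cinner d (mvec d X (a j)) (mvec d X (a k)) = cinner d (a j) (mvec d G (a k))"
      by (simp add: G_def cinner_mvec_gram)
    also have "\<dots> = cinner d (a j) (\<lambda>r. of_real (l k) * a k r)"
      using l that by (intro cinner_cong) auto
    finally show ?thesis using a that by (simp add: cinner_scale_right onb_def)
  qed
  have lsq: "l k = sqnorm d (mvec d X (a k))" if "k < d" for k
    using gram[OF that that] by (simp add: cinner_self del: of_real_eq_iff) (simp only: of_real_eq_iff)
  define s where "s = (\<lambda>k. sqrt (l k))"
  \<comment> \<open>Only nonzero images can be normalised; at the other indices \<open>X\<close>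
    annihilates \<open>a k\<close>, and any completion of the basis will do.\<close>
  define I where "I = {k. k < d \<and> l k \<noteq> 0}"
  have pos: "l k > 0" if "k \<in> I" for k
    using that lsq[of k] sqnorm_nonneg[of d "mvec d X (a k)"] by (auto simp: I_def less_le)
  define v where "v = (\<lambda>k r. of_real (1 / s k) * mvec d X (a k) r)"
  have "\<exists>b. onb d b \<and> (\<forall>i\<in>I. b i = v i)"
  proof (rule orthonormal_extend)
    show "cinner d (v i) (v j) = (if i = j then 1 else 0)" if "i \<in> I" "j \<in> I" for i j
    proof -
      have "cinner d (v i) (v j) = of_real (1 / s i) * of_real (1 / s j) * (if i = j then of_real (l j) else 0)"
        unfolding v_def cinner_scale_left cinner_scale_right using that gram[of i j] by (simp add: I_def)
      also have "\<dots> = (if i = j then of_real (1 / s i * (1 / s j) * l j) else 0)" by simp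
      also have "\<dots> = (if i = j then 1 else 0)" using pos[OF that(2)] by (simp add: s_def field_simps)
      finally show ?thesis .
    qed
  qed (auto simp: I_def)
  then obtain b where b: "onb d b" "\<And>i. i \<in> I \<Longrightarrow> b i = v i" by blast
  have Xa: "mvec d X (a k) r = of_real (s k) * b k r" if "k < d" "r < d" for k r
  proof (cases "l k = 0")
    case True
    then have "mvec d X (a k) r = 0" using lsq[of k] that by (simp add: sqnorm_eq_0_iff)
    then show ?thesis using True by (simp add: s_def)
  next
    case False
    then have I: "k \<in> I" using that by (simp add: I_def)
    then have "s k \<noteq> 0" using pos by (force simp: s_def)
    then show ?thesis using b(2)[OF I] by (simp add: v_def)
  qed
  have "svd d X a b s"
    unfolding svd_def using a b onb_expand_matrix[OF a, of _ _ X] Xa lsq by (auto simp: s_def)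
  moreover have "singular_values (mat d d (\<lambda>(r, c). X r c)) = image_mset s (mset_set {..<d})"
  proof -
    let ?A = "mat d d (\<lambda>(r, c). X r c)"
    have H: "mat_adjoint ?A * ?A = mat d d (\<lambda>(r, c). G r c)"
      by (intro eq_matI) (auto simp: mat_adjoint_def mat_of_rows_def scalar_prod_def G_def atLeast0LessThan)
    have "proots (char_poly (mat_adjoint ?A * ?A)) = image_mset (\<lambda>k. of_real (l k)) (mset_set {..<d})"
    proof (rule proots_char_poly_spectral[OF _ a])
      fix k r assume kr: "k < d" "r < d"
      then have "mvec d (\<lambda>r c. (mat_adjoint ?A * ?A) $$ (r, c)) (a k) r = mvec d G (a k) r"
        unfolding mvec_def H by (intro sum.cong refl) auto
      then show "mvec d (\<lambda>r c. (mat_adjoint ?A * ?A) $$ (r, c)) (a k) r = of_real (l k) * a k r"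
        using l kr by simp
    qed (simp add: H)
    then show ?thesis by (simp add: singular_values_def s_def multiset.map_comp o_def)
  qed
  ultimately show ?thesis by blast
qed

section \<open>Bilinear forms and lengths in singular bases\<close>

lemma svd_cinner:
  assumes "svd d X a b s"
  shows "cinner d y (mvec d X x) = (\<Sum>k<d. of_real (s k) * cinner d y (b k) * cinner d (a k) x)"
proof -
  have "mvec d X x r = (\<Sum>k<d. (of_real (s k) * cinner d (a k) x) * b k r)" if "r < d" for r
  proof -
    have "mvec d X x r = (\<Sum>c<d. \<Sum>k<d. of_real (s k) * b k r * cnj (a k c) * x c)"
      using assms that by (simp add: mvec_def svd_def sum_distrib_right)
    also have "\<dots> = (\<Sum>k<d. (of_real (s k) * cinner d (a k) x) * b k r)"
      by (subst sum.swap) (simp add: cinner_def sum_distrib_left sum_distrib_right mult_ac)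
    finally show ?thesis .
  qed
  then have "cinner d y (mvec d X x) = cinner d y (\<lambda>r. \<Sum>k<d. (of_real (s k) * cinner d (a k) x) * b k r)"
    by (intro cinner_cong) auto
  then show ?thesis unfolding cinner_sum_right by (simp only: mult_ac)
qed

lemma svd_Re_cinner:
  assumes "svd d X a b s"
  shows "Re (cinner d y (mvec d X x)) = (\<Sum>k<d. s k * Re (cinner d y (b k) * cinner d (a k) x))"
  unfolding svd_cinner[OF assms] Re_sum by (intro sum.cong refl) (simp add: algebra_simps)

lemma svd_adj:
  assumes "svd d X a b s"
  shows "svd d (adj X) b a s"
  using assms by (auto simp: svd_def adj_def intro!: sum.cong)

lemma svd_mvec_right:
  assumes "svd d X a b s" "k < d"
  shows "cinner d y (mvec d X (a k)) = of_real (s k) * cinner d y (b k)"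
proof -
  have "cinner d y (mvec d X (a k)) = (\<Sum>j<d. of_real (s j) * cinner d y (b j) * (if j = k then 1 else 0))"
    using assms unfolding svd_cinner[OF assms(1)] by (intro sum.cong refl) (auto simp: svd_def onb_def)
  then show ?thesis using assms(2) by (simp add: if_distrib[of "\<lambda>z. _ * z"] cong: if_cong)
qed

lemma svd_sqnorm:
  assumes "svd d X a b s"
  shows "sqnorm d (mvec d X x) = (\<Sum>k<d. (s k)\<^sup>2 * (cmod (cinner d (a k) x))\<^sup>2)"
proof -
  have "cmod (cinner d (b k) (mvec d X x)) = s k * cmod (cinner d (a k) x)" if "k < d" for k
  proof -
    have "cinner d (b k) (mvec d X x) = cnj (cinner d x (mvec d (adj X) (b k)))"
      by (simp add: cnj_cinner) (simp add: cinner_mvec_adj)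
    also have "\<dots> = of_real (s k) * cinner d (a k) x"
      using svd_mvec_right[OF svd_adj[OF assms] that, of x] by (simp add: cnj_cinner)
    finally show ?thesis using assms that by (simp add: norm_mult svd_def)
  qed
  moreover have "onb d b" using assms by (simp add: svd_def)
  ultimately show ?thesis by (simp add: sqnorm_parseval power_mult_distrib)
qed

section \<open>Power sums of singular values against arbitrary orthonormal bases\<close>

text \<open>A diagonal entry is dominated by a mean of the \<open>s k\<close> with doubly stochastic
  weights \<open>c i k\<close>: unit row sums permit Jensen's inequality, unit column sums collapse
  the result. With \<open>svd_diagonal_eq\<close> this exhibits the p-th power of the norm as a
  maximum over pairs of bases, the source of convexity and of the triangle inequality.\<close>

lemma svd_diagonal_le:
  assumes X: "svd d X a b s" and u: "onb d u" and v: "onb d v" and p: "p \<ge> 1"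
  shows "(\<Sum>i<d. cmod (cinner d (v i) (mvec d X (u i))) powr p) \<le> (\<Sum>k<d. s k powr p)"
proof -
  have a: "onb d a" and b: "onb d b" and s: "\<And>k. k < d \<Longrightarrow> 0 \<le> s k" using X by (auto simp: svd_def)
  \<comment> \<open>The product of two overlaps is at most the mean of their squares, and these
    squares are doubly stochastic by Parseval.\<close>
  define c where "c = (\<lambda>i k. ((cmod (cinner d (v i) (b k)))\<^sup>2 + (cmod (cinner d (a k) (u i)))\<^sup>2) / 2)"
  have c1: "(\<Sum>k<d. c i k) = 1" if "i < d" for i
    using onb_sum_right[OF v b that] onb_sum_left[OF a u that]
    by (simp add: c_def sum.distrib flip: sum_divide_distrib)
  have c2: "(\<Sum>i<d. c i k) = 1" if "k < d" for k
    using onb_sum_left[OF v b that] onb_sum_right[OF a u that]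
    by (simp add: c_def sum.distrib flip: sum_divide_distrib)
  have "cmod (cinner d (v i) (mvec d X (u i))) powr p \<le> (\<Sum>k<d. c i k * s k powr p)" if i: "i < d" for i
  proof -
    have "cmod (cinner d (v i) (mvec d X (u i))) \<le> (\<Sum>k<d. s k * (cmod (cinner d (v i) (b k)) * cmod (cinner d (a k) (u i))))"
      unfolding svd_cinner[OF X] using s by (intro sum_norm_le) (simp add: norm_mult)
    also have "\<dots> \<le> (\<Sum>k<d. s k * c i k)"
    proof (intro sum_mono mult_left_mono)
      fix k show "cmod (cinner d (v i) (b k)) * cmod (cinner d (a k) (u i)) \<le> c i k"
        using sum_squares_bound[of "cmod (cinner d (v i) (b k))" "cmod (cinner d (a k) (u i))"]
        by (simp add: c_def)
    qed (use s in auto)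
    finally have "cmod (cinner d (v i) (mvec d X (u i))) powr p \<le> (\<Sum>k<d. c i k * s k) powr p"
      using p by (intro powr_mono2) (auto simp: mult.commute)
    also have "\<dots> \<le> (\<Sum>k<d. c i k * s k powr p)"
      using p s c1[OF i] by (intro subconvex_sum_powr) (auto simp: c_def)
    finally show ?thesis .
  qed
  then have "(\<Sum>i<d. cmod (cinner d (v i) (mvec d X (u i))) powr p) \<le> (\<Sum>i<d. \<Sum>k<d. c i k * s k powr p)"
    by (intro sum_mono) auto
  also have "\<dots> = (\<Sum>k<d. (\<Sum>i<d. c i k) * s k powr p)"
    by (subst sum.swap) (simp add: sum_distrib_right)
  also have "\<dots> = (\<Sum>k<d. s k powr p)" by (intro sum.cong refl) (simp add: c2)
  finally show ?thesis .
qed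

lemma svd_diagonal_eq:
  assumes X: "svd d X a b s"
  shows "(\<Sum>i<d. cmod (cinner d (b i) (mvec d X (a i))) powr p) = (\<Sum>k<d. s k powr p)"
proof (intro sum.cong refl)
  fix i assume "i \<in> {..<d}"
  then have i: "i < d" by simp
  show "cmod (cinner d (b i) (mvec d X (a i))) powr p = s i powr p"
    unfolding svd_mvec_right[OF X i] using X i by (simp add: svd_def onb_def)
qed

lemma powr_half_square: "0 \<le> (x::real) \<Longrightarrow> (x\<^sup>2) powr (p / 2) = x powr p"
  by (simp add: powr_powr flip: powr_numeral)

text \<open>The squared length of a column is a mean of the \<open>(s k)^2\<close> with doubly
  stochastic weights, and the power \<open>p / 2\<close> is convex.\<close>

lemma svd_columns_le:
  assumes X: "svd d X a b s" and u: "onb d u" and p: "p \<ge> 2"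
  shows "(\<Sum>i<d. sqnorm d (mvec d X (u i)) powr (p / 2)) \<le> (\<Sum>k<d. s k powr p)"
proof -
  have a: "onb d a" and s: "\<And>k. k < d \<Longrightarrow> 0 \<le> s k" using X by (auto simp: svd_def)
  have "(\<Sum>i<d. sqnorm d (mvec d X (u i)) powr (p / 2))
      \<le> (\<Sum>i<d. \<Sum>k<d. (cmod (cinner d (a k) (u i)))\<^sup>2 * ((s k)\<^sup>2) powr (p / 2))"
  proof (intro sum_mono)
    fix i assume "i \<in> {..<d}"
    then show "sqnorm d (mvec d X (u i)) powr (p / 2)
      \<le> (\<Sum>k<d. (cmod (cinner d (a k) (u i)))\<^sup>2 * ((s k)\<^sup>2) powr (p / 2))"
      using subconvex_sum_powr[of "{..<d}" "p/2" "\<lambda>k. (cmod (cinner d (a k) (u i)))\<^sup>2" "\<lambda>k. (s k)\<^sup>2"]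
        p onb_sum_left[OF a u, of i] by (simp add: svd_sqnorm[OF X] mult.commute)
  qed
  also have "\<dots> = (\<Sum>k<d. (\<Sum>i<d. (cmod (cinner d (a k) (u i)))\<^sup>2) * s k powr p)"
    by (subst sum.swap) (simp add: sum_distrib_right powr_half_square s)
  also have "\<dots> = (\<Sum>k<d. s k powr p)"
    by (intro sum.cong refl) (simp add: onb_sum_right[OF a u])
  finally show ?thesis .
qed

text \<open>The same means as in \<open>svd_columns_le\<close>, with the power \<open>p / 2\<close>
  now concave.\<close>

lemma svd_columns_ge:
  assumes X: "svd d X a b s" and u: "onb d u" and p: "0 < p" "p \<le> 2"
  shows "(\<Sum>k<d. s k powr p) \<le> (\<Sum>i<d. sqnorm d (mvec d X (u i)) powr (p / 2))"
proof -
  have a: "onb d a" and s: "\<And>k. k < d \<Longrightarrow> 0 \<le> s k" using X by (auto simp: svd_def)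
  have "(\<Sum>k<d. s k powr p) = (\<Sum>k<d. (\<Sum>i<d. (cmod (cinner d (a k) (u i)))\<^sup>2) * s k powr p)"
    by (intro sum.cong refl) (simp add: onb_sum_right[OF a u])
  also have "\<dots> = (\<Sum>i<d. \<Sum>k<d. (cmod (cinner d (a k) (u i)))\<^sup>2 * ((s k)\<^sup>2) powr (p / 2))"
    by (subst sum.swap) (simp add: sum_distrib_right powr_half_square s)
  also have "\<dots> \<le> (\<Sum>i<d. sqnorm d (mvec d X (u i)) powr (p / 2))"
  proof (intro sum_mono)
    fix i assume "i \<in> {..<d}"
    then show "(\<Sum>k<d. (cmod (cinner d (a k) (u i)))\<^sup>2 * ((s k)\<^sup>2) powr (p / 2))
      \<le> sqnorm d (mvec d X (u i)) powr (p / 2)"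
      using subconcave_sum_powr[of "{..<d}" "p/2" "\<lambda>k. (cmod (cinner d (a k) (u i)))\<^sup>2" "\<lambda>k. (s k)\<^sup>2"]
        p onb_sum_left[OF a u, of i] by (simp add: svd_sqnorm[OF X] mult.commute)
  qed
  finally show ?thesis .
qed

section \<open>Two-point inequalities\<close>

lemma mvec_add: "mvec d (\<lambda>r c. X r c + Y r c) x = (\<lambda>r. mvec d X x r + mvec d Y x r)"
  by (simp add: mvec_def algebra_simps sum.distrib)

lemma mvec_diff: "mvec d (\<lambda>r c. X r c - Y r c) x = (\<lambda>r. mvec d X x r - mvec d Y x r)"
  by (simp add: mvec_def algebra_simps sum_subtractf)

lemma sqnorm_diff: "sqnorm d (\<lambda>r. x r - y r) = sqnorm d x + sqnorm d y - 2 * Re (cinner d x y)"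
proof -
  have "(cmod (a - b))\<^sup>2 = (cmod a)\<^sup>2 + (cmod b)\<^sup>2 - 2 * Re (cnj a * b)" for a b
    unfolding cmod_power2 by (simp add: power2_eq_square algebra_simps)
  then show ?thesis
    unfolding sqnorm_def cinner_def Re_sum sum_distrib_left sum.distrib[symmetric] sum_subtractf[symmetric]
    by (intro sum.cong refl)
qed

lemma sqnorm_parallelogram:
  "sqnorm d (\<lambda>r. x r + y r) + sqnorm d (\<lambda>r. x r - y r) = 2 * (sqnorm d x + sqnorm d y)"
proof -
  have "(cmod (a + b))\<^sup>2 + (cmod (a - b))\<^sup>2 = 2 * ((cmod a)\<^sup>2 + (cmod b)\<^sup>2)" for a b
    unfolding cmod_power2 by (simp add: power2_eq_square algebra_simps)
  then show ?thesis
    unfolding sqnorm_def sum.distrib[symmetric] sum_distrib_left by (intro sum.cong refl)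
qed

section \<open>Clarkson's inequality for exponents at most 2\<close>

text \<open>Let \<open>L\<close> have eigenvalues \<open>l i\<close> on the basis \<open>u\<close>.
  The hypothesis says that the Gram matrix of \<open>X\<close> is at most \<open>L\<close>; the
  claim compares the trace of its product with the power \<open>p / 2 - 1\<close> of
  \<open>L\<close> to the trace of its own power \<open>p / 2\<close>. Domination forces the weights
  \<open>c k i\<close> to have sum at most 1 over \<open>i\<close>, and concave Jensen applies for
  each \<open>k\<close>.\<close>

lemma svd_dominated_sum_le:
  assumes X: "svd d X a b s" and u: "onb d u" and l: "\<And>i. i < d \<Longrightarrow> 0 \<le> l i"
    and dom: "\<And>x. sqnorm d (mvec d X x) \<le> (\<Sum>i<d. l i * (cmod (cinner d (u i) x))\<^sup>2)"
    and p: "0 < p" "p \<le> 2"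
  shows "(\<Sum>i<d. sqnorm d (mvec d X (u i)) / l i * l i powr (p / 2)) \<le> (\<Sum>k<d. s k powr p)"
proof -
  have a: "onb d a" and s: "\<And>k. k < d \<Longrightarrow> 0 \<le> s k" using X by (auto simp: svd_def)
  define c where "c = (\<lambda>k i. (s k)\<^sup>2 * (cmod (cinner d (a k) (u i)))\<^sup>2 / l i)"
  have c0: "0 \<le> c k i" if "i < d" for k i using l[OF that] by (simp add: c_def)
  have c1: "(\<Sum>i<d. c k i) \<le> 1" if k: "k < d" for k
  proof -
    define T where "T = (\<Sum>i<d. (cmod (cinner d (a k) (u i)))\<^sup>2 / l i)"
    have T: "0 \<le> T" unfolding T_def using l by (intro sum_nonneg) auto
    \<comment> \<open>Test the domination on \<open>a k\<close> divided by \<open>l\<close> in the basis \<open>u\<close>; a vanishing \<open>l i\<close> drops out as \<open>x / 0 = 0\<close>.\<close>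
    define x where "x = (\<lambda>r. \<Sum>i<d. (cinner d (u i) (a k) / of_real (l i)) * u i r)"
    have ux: "cinner d (u j) x = cinner d (u j) (a k) / of_real (l j)" if "j < d" for j
    proof -
      have "cinner d (u j) x = (\<Sum>i<d. (cinner d (u i) (a k) / of_real (l i)) * (if i = j then 1 else 0))"
        unfolding x_def cinner_sum_right using u that by (intro sum.cong refl) (auto simp: onb_def)
      then show ?thesis using that by (simp add: if_distrib[of "\<lambda>z. _ * z"] cong: if_cong)
    qed
    have "cinner d (a k) x = (\<Sum>i<d. (cinner d (u i) (a k) / of_real (l i)) * cinner d (a k) (u i))"
      unfolding x_def cinner_sum_right ..
    also have "\<dots> = of_real T"
      unfolding T_def of_real_sum
    proof (intro sum.cong refl)
      fix i
      have "cinner d (u i) (a k) * cinner d (a k) (u i) = of_real ((cmod (cinner d (a k) (u i)))\<^sup>2)"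
        using complex_norm_square[of "cinner d (a k) (u i)"] by (simp add: cnj_cinner mult.commute)
      then show "cinner d (u i) (a k) / of_real (l i) * cinner d (a k) (u i)
          = of_real ((cmod (cinner d (a k) (u i)))\<^sup>2 / l i)" by simp
    qed
    finally have ax: "cinner d (a k) x = of_real T" .
    \<comment> \<open>Keeping only the term \<open>j = k\<close> of the squared length turns the
      domination into \<open>(s k)^2 * T^2 <= T\<close>.\<close>
    have "(s k)\<^sup>2 * T\<^sup>2 = (s k)\<^sup>2 * (cmod (cinner d (a k) x))\<^sup>2" by (simp add: ax)
    also have "\<dots> \<le> (\<Sum>j<d. (s j)\<^sup>2 * (cmod (cinner d (a j) x))\<^sup>2)"
      using k by (intro member_le_sum) auto
    also have "\<dots> = sqnorm d (mvec d X x)" by (simp add: svd_sqnorm[OF X])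
    also have "\<dots> \<le> (\<Sum>i<d. l i * (cmod (cinner d (u i) x))\<^sup>2)" by (rule dom)
    also have "\<dots> = T" unfolding T_def
    proof (intro sum.cong refl)
      fix i assume "i \<in> {..<d}"
      then have "i < d" by simp
      then have "l i * (cmod (cinner d (u i) x))\<^sup>2 = l i * ((cmod (cinner d (a k) (u i)))\<^sup>2 / (l i)\<^sup>2)"
        using l[of i] by (simp add: ux norm_divide power_divide norm_cinner_commute[of d "u i"])
      then show "l i * (cmod (cinner d (u i) x))\<^sup>2 = (cmod (cinner d (a k) (u i)))\<^sup>2 / l i"
        by (simp add: power2_eq_square)
    qed
    finally have "(s k)\<^sup>2 * T * T \<le> 1 * T" by (simp add: power2_eq_square mult.assoc)
    then have "(s k)\<^sup>2 * T \<le> 1" using T by (cases "T = 0") auto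
    then show ?thesis by (simp add: c_def T_def sum_distrib_left)
  qed
  have "(\<Sum>i<d. sqnorm d (mvec d X (u i)) / l i * l i powr (p / 2)) = (\<Sum>i<d. \<Sum>k<d. c k i * l i powr (p / 2))"
    by (simp add: svd_sqnorm[OF X] c_def sum_divide_distrib sum_distrib_right)
  also have "\<dots> = (\<Sum>k<d. \<Sum>i<d. c k i * l i powr (p / 2))" by (rule sum.swap)
  also have "\<dots> \<le> (\<Sum>k<d. s k powr p)"
  proof (intro sum_mono)
    fix k assume "k \<in> {..<d}"
    then have k: "k < d" by simp
    have "(\<Sum>i<d. c k i * l i powr (p / 2)) \<le> (\<Sum>i<d. c k i * l i) powr (p / 2)"
      using p l c0 c1[OF k] by (intro subconcave_sum_powr) auto
    \<comment> \<open>Indices with \<open>l i = 0\<close> contribute 0 to the left side, since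
      \<open>c k i\<close> vanishes there; hence an inequality.\<close>
    also have "\<dots> \<le> (\<Sum>i<d. (s k)\<^sup>2 * (cmod (cinner d (a k) (u i)))\<^sup>2) powr (p / 2)"
      using p l c0 by (intro powr_mono2 sum_mono sum_nonneg) (auto simp: c_def)
    also have "(\<Sum>i<d. (s k)\<^sup>2 * (cmod (cinner d (a k) (u i)))\<^sup>2) = (s k)\<^sup>2"
      using onb_sum_right[OF a u k] by (simp flip: sum_distrib_left)
    also have "((s k)\<^sup>2) powr (p / 2) = s k powr p" by (rule powr_half_square[OF s[OF k]])
    finally show "(\<Sum>i<d. c k i * l i powr (p / 2)) \<le> s k powr p" .
  qed
  finally show ?thesis .
qed

text \<open>For an eigenvector \<open>u i\<close> of the sum \<open>G\<close> of both Gram matrices,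
  the squared lengths of the columns of \<open>X + Y\<close> and \<open>X - Y\<close> have mean
  \<open>l i\<close>. Concavity gives \<open>2 * l i powr (p / 2)\<close>, and
  \<open>svd_dominated_sum_le\<close> bounds the shares of \<open>X\<close> and \<open>Y\<close> in
  it.\<close>

lemma svd_Clarkson:
  assumes X: "svd d X a b s" and Y: "svd d Y a' b' t"
    and P: "svd d (\<lambda>r c. X r c + Y r c) aP bP x" and Q: "svd d (\<lambda>r c. X r c - Y r c) aQ bQ y"
    and p: "0 < p" "p \<le> 2"
  shows "(\<Sum>k<d. x k powr p) + (\<Sum>k<d. y k powr p) \<le> 2 * ((\<Sum>k<d. s k powr p) + (\<Sum>k<d. t k powr p))"
proof -
  define G1 where "G1 = (\<lambda>r c. \<Sum>t<d. cnj (X t r) * X t c)"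
  define G2 where "G2 = (\<lambda>r c. \<Sum>t<d. cnj (Y t r) * Y t c)"
  define G where "G = (\<lambda>r c. G1 r c + G2 r c)"
  obtain u l where u: "onb d u"
    and l: "\<And>k r. k < d \<Longrightarrow> r < d \<Longrightarrow> mvec d G (u k) r = complex_of_real (l k) * u k r"
    using hermitian_spectral[of d G] by (auto simp: G_def G1_def G2_def mult.commute)
  have G: "cinner d y (mvec d G x) = cinner d (mvec d X y) (mvec d X x) + cinner d (mvec d Y y) (mvec d Y x)" for x y
    unfolding cinner_mvec_gram[symmetric] G_def mvec_add G1_def G2_def
    by (simp add: cinner_def algebra_simps sum.distrib)
  have Gu: "cinner d x (mvec d G (u i)) = of_real (l i) * cinner d x (u i)" if "i < d" for i x
    unfolding cinner_scale_right[symmetric] using l that by (intro cinner_cong) auto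
  have uG: "cinner d (u i) (mvec d G x) = of_real (l i) * cinner d (u i) x" if "i < d" for i x
  proof -
    have "cinner d (u i) (mvec d G x) = cnj (cinner d x (mvec d G (u i)))" by (simp add: G cnj_cinner)
    then show ?thesis by (simp add: Gu[OF that] cnj_cinner)
  qed
  have norms: "sqnorm d (mvec d X x) + sqnorm d (mvec d Y x) = (\<Sum>i<d. l i * (cmod (cinner d (u i) x))\<^sup>2)" for x
  proof -
    have "complex_of_real (sqnorm d (mvec d X x) + sqnorm d (mvec d Y x)) = cinner d x (mvec d G x)"
      by (simp add: G cinner_self)
    also have "\<dots> = (\<Sum>i<d. of_real (l i) * (cinner d (u i) x * cinner d x (u i)))"
      by (subst cinner_parseval[OF u]) (intro sum.cong refl, simp add: uG)
    also have "\<dots> = (\<Sum>i<d. of_real (l i * (cmod (cinner d (u i) x))\<^sup>2))"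
    proof (intro sum.cong refl)
      fix i show "of_real (l i) * (cinner d (u i) x * cinner d x (u i)) = complex_of_real (l i * (cmod (cinner d (u i) x))\<^sup>2)"
        using complex_norm_square[of "cinner d (u i) x"] by (simp add: cnj_cinner)
    qed
    also have "\<dots> = of_real (\<Sum>i<d. l i * (cmod (cinner d (u i) x))\<^sup>2)" by simp
    finally show ?thesis by (simp only: of_real_eq_iff)
  qed
  have li: "l i = sqnorm d (mvec d X (u i)) + sqnorm d (mvec d Y (u i))" if "i < d" for i
  proof -
    have "complex_of_real (sqnorm d (mvec d X (u i)) + sqnorm d (mvec d Y (u i))) = cinner d (u i) (mvec d G (u i))"
      by (simp add: G cinner_self)
    also have "\<dots> = of_real (l i)" using u that by (simp add: Gu onb_def)
    finally show ?thesis by (simp only: of_real_eq_iff)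
  qed
  then have l0: "0 \<le> l i" if "i < d" for i using that by simp
  \<comment> \<open>Jensen's inequality with two weights \<open>1 / 2\<close>, indexed by the
    Booleans.\<close>
  have concave: "A powr (p / 2) + B powr (p / 2) \<le> 2 * ((A + B) / 2) powr (p / 2)" if "0 \<le> A" "0 \<le> B" for A B
  proof -
    have "(\<Sum>z\<in>UNIV. 1 / 2 * (if z then A else B) powr (p / 2)) \<le> (\<Sum>z\<in>UNIV. 1 / 2 * (if z then A else B)) powr (p / 2)"
      using p that by (intro subconcave_sum_powr) auto
    then show ?thesis by (simp add: UNIV_bool add_divide_distrib add.commute)
  qed
  have "(\<Sum>k<d. x k powr p) + (\<Sum>k<d. y k powr p)
    \<le> (\<Sum>i<d. sqnorm d (mvec d (\<lambda>r c. X r c + Y r c) (u i)) powr (p / 2) + sqnorm d (mvec d (\<lambda>r c. X r c - Y r c) (u i)) powr (p / 2))"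
    using svd_columns_ge[OF P u p] svd_columns_ge[OF Q u p] by (simp add: sum.distrib)
  also have "\<dots> \<le> (\<Sum>i<d. 2 * l i powr (p / 2))"
  proof (intro sum_mono)
    fix i assume "i \<in> {..<d}"
    then show "sqnorm d (mvec d (\<lambda>r c. X r c + Y r c) (u i)) powr (p / 2) + sqnorm d (mvec d (\<lambda>r c. X r c - Y r c) (u i)) powr (p / 2)
        \<le> 2 * l i powr (p / 2)"
      using concave[OF sqnorm_nonneg sqnorm_nonneg, of d "mvec d (\<lambda>r c. X r c + Y r c) (u i)" d "mvec d (\<lambda>r c. X r c - Y r c) (u i)"]
        sqnorm_parallelogram[of d "mvec d X (u i)" "mvec d Y (u i)"]
      by (simp add: mvec_add mvec_diff li add_divide_distrib)
  qed
  \<comment> \<open>\<open>l i\<close> is the sum of the two squared lengths, so the power splits in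
    proportion to them; for \<open>l i = 0\<close> both sides are 0.\<close>
  also have "\<dots> = 2 * ((\<Sum>i<d. sqnorm d (mvec d X (u i)) / l i * l i powr (p / 2))
      + (\<Sum>i<d. sqnorm d (mvec d Y (u i)) / l i * l i powr (p / 2)))"
    unfolding sum_distrib_left[symmetric] sum.distrib[symmetric]
  proof (intro arg_cong[where f = "\<lambda>z. 2 * z"] sum.cong refl)
    fix i assume "i \<in> {..<d}"
    then show "l i powr (p / 2) = sqnorm d (mvec d X (u i)) / l i * l i powr (p / 2)
        + sqnorm d (mvec d Y (u i)) / l i * l i powr (p / 2)"
      using li[of i] by (cases "l i = 0") (auto simp flip: distrib_right add_divide_distrib)
  qed
  also have "\<dots> \<le> 2 * ((\<Sum>k<d. s k powr p) + (\<Sum>k<d. t k powr p))"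
  proof -
    have "sqnorm d (mvec d X x) \<le> (\<Sum>i<d. l i * (cmod (cinner d (u i) x))\<^sup>2)"
      "sqnorm d (mvec d Y x) \<le> (\<Sum>i<d. l i * (cmod (cinner d (u i) x))\<^sup>2)" for x
      using norms[of x] sqnorm_nonneg[of d "mvec d X x"] sqnorm_nonneg[of d "mvec d Y x"] by linarith+
    then show ?thesis using svd_dominated_sum_le[OF X u, of l p] svd_dominated_sum_le[OF Y u, of l p] l0 p
      by (intro mult_left_mono add_mono) auto
  qed
  finally show ?thesis .
qed

section \<open>Smoothness for exponents at least 2\<close>

text \<open>First-order convexity at \<open>M\<close>: the midpoint is tested on the singular bases
  of \<open>M\<close>, where its diagonal has real parts halfway between \<open>m i\<close> and
  those of \<open>N\<close>. The scalar tangent bound at \<open>m i\<close> and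
  \<open>svd_diagonal_le\<close> finish.\<close>

lemma svd_tangent:
  assumes M: "svd d M a b m" and N: "svd d N c e n" and X: "svd d (\<lambda>r k. (M r k + N r k) / 2) xa xb x"
    and p: "p \<ge> 1"
  shows "(\<Sum>i<d. m i powr p) - (\<Sum>i<d. x i powr p)
    \<le> p / 2 * (\<Sum>i<d. m i powr (p - 1) * (m i - (\<Sum>j<d. n j * Re (cinner d (b i) (e j) * cinner d (c j) (a i)))))"
proof -
  have a: "onb d a" and b: "onb d b" and m: "\<And>k. k < d \<Longrightarrow> 0 \<le> m k" using M by (auto simp: svd_def)
  let ?X = "\<lambda>r k. (M r k + N r k) / 2"
  \<comment> \<open>The real part of the diagonal entry of \<open>N\<close> in the singular bases of
    \<open>M\<close>, expanded in the decomposition of \<open>N\<close>.\<close>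
  define \<nu> where "\<nu> = (\<lambda>i. \<Sum>j<d. n j * Re (cinner d (b i) (e j) * cinner d (c j) (a i)))"
  have form: "Re (cinner d (b i) (mvec d ?X (a i))) = (m i + \<nu> i) / 2" if "i < d" for i
  proof -
    have "cinner d (b i) (mvec d ?X (a i)) = (cinner d (b i) (mvec d M (a i)) + cinner d (b i) (mvec d N (a i))) / 2"
      by (simp add: cinner_def mvec_def sum_distrib_left distrib_left distrib_right add_divide_distrib sum.distrib sum_divide_distrib)
    also have "cinner d (b i) (mvec d M (a i)) = of_real (m i)"
      using b that by (simp add: svd_mvec_right[OF M that] onb_def)
    finally have "Re (cinner d (b i) (mvec d ?X (a i))) = (m i + Re (cinner d (b i) (mvec d N (a i)))) / 2"
      by (simp only: Re_divide_numeral plus_complex.sel Re_complex_of_real)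
    then show ?thesis unfolding svd_Re_cinner[OF N] \<nu>_def .
  qed
  have "(\<Sum>i<d. m i powr p + p * m i powr (p - 1) * ((m i + \<nu> i) / 2 - m i))
      \<le> (\<Sum>i<d. cmod (cinner d (b i) (mvec d ?X (a i))) powr p)"
  proof (intro sum_mono)
    fix i assume "i \<in> {..<d}"
    then have i: "i < d" by simp
    have "m i powr p + p * m i powr (p - 1) * ((m i + \<nu> i) / 2 - m i)
        \<le> m i powr p + p * m i powr (p - 1) * (cmod (cinner d (b i) (mvec d ?X (a i))) - m i)"
      using complex_Re_le_cmod[of "cinner d (b i) (mvec d ?X (a i))"] p
      by (intro add_left_mono mult_left_mono) (auto simp: form[OF i])
    also have "\<dots> \<le> cmod (cinner d (b i) (mvec d ?X (a i))) powr p"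
      using p m[OF i] by (intro powr_ge_tangent) auto
    finally show "m i powr p + p * m i powr (p - 1) * ((m i + \<nu> i) / 2 - m i)
      \<le> cmod (cinner d (b i) (mvec d ?X (a i))) powr p" .
  qed
  also have "\<dots> \<le> (\<Sum>i<d. x i powr p)" by (rule svd_diagonal_le[OF X a b p])
  finally have "(\<Sum>i<d. m i powr p) - (\<Sum>i<d. x i powr p) \<le> - (\<Sum>i<d. p * m i powr (p - 1) * ((m i + \<nu> i) / 2 - m i))"
    by (simp add: sum.distrib)
  also have "\<dots> = p / 2 * (\<Sum>i<d. m i powr (p - 1) * (m i - \<nu> i))"
    unfolding sum_negf[symmetric] sum_distrib_left by (intro sum.cong refl) (simp add: field_simps)
  finally show ?thesis by (simp add: \<nu>_def)
qed

text \<open>The square is expanded in the singular bases of \<open>N\<close>, and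
  \<open>(m i)^2\<close> is spread over \<open>j\<close> by unit row sums, so that everything
  becomes one sum over pairs of singular values.\<close>

lemma svd_sqnorm_diff:
  assumes M: "svd d M a b m" and N: "svd d N c e n" and i: "i < d"
  shows "sqnorm d (mvec d (\<lambda>r k. M r k - N r k) (a i)) =
    (\<Sum>j<d. (cmod (cinner d (a i) (c j)))\<^sup>2 * ((m i)\<^sup>2 + (n j)\<^sup>2)
      - 2 * (m i * n j * Re (cinner d (b i) (e j) * cinner d (c j) (a i))))"
proof -
  have a: "onb d a" and c: "onb d c" using M N by (auto simp: svd_def)
  have 1: "sqnorm d (mvec d M (a i)) = (m i)\<^sup>2"
  proof -
    have "sqnorm d (mvec d M (a i)) = (\<Sum>k<d. (m k)\<^sup>2 * (if k = i then 1 else 0))"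
      unfolding svd_sqnorm[OF M] using a i by (intro sum.cong refl) (auto simp: onb_def)
    then show ?thesis using i by (simp add: if_distrib[of "\<lambda>z. _ * z"] cong: if_cong)
  qed
  have 2: "sqnorm d (mvec d N (a i)) = (\<Sum>j<d. (n j)\<^sup>2 * (cmod (cinner d (a i) (c j)))\<^sup>2)"
    unfolding svd_sqnorm[OF N] by (simp add: norm_cinner_commute)
  have 3: "cinner d (mvec d M (a i)) (mvec d N (a i)) = of_real (m i) * cinner d (b i) (mvec d N (a i))"
  proof -
    have "cinner d (mvec d M (a i)) (mvec d N (a i)) = cnj (cinner d (mvec d N (a i)) (mvec d M (a i)))"
      by (simp add: cnj_cinner)
    then show ?thesis by (simp add: svd_mvec_right[OF M i] cnj_cinner)
  qed
  have 4: "(\<Sum>j<d. (cmod (cinner d (a i) (c j)))\<^sup>2 * (m i)\<^sup>2) = (m i)\<^sup>2"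
    using onb_sum_right[OF a c i] by (simp flip: sum_distrib_right)
  have 5: "Re (of_real (m i) * cinner d (b i) (mvec d N (a i)))
      = m i * (\<Sum>j<d. n j * Re (cinner d (b i) (e j) * cinner d (c j) (a i)))"
    by (simp add: svd_Re_cinner[OF N])
  show ?thesis
    unfolding mvec_diff sqnorm_diff 1 2 3 5 distrib_left sum_subtractf sum.distrib 4
    by (simp add: sum_distrib_left mult_ac del: times_complex.sel)
qed

text \<open>The mean of the summand in \<open>svd_sqnorm_diff\<close> and its counterpart for the
  adjoints. Averaging makes it symmetric in the two decompositions, so that summing over either
  index gives mean squared column lengths of the difference.\<close>

definition svd_overlap :: "nat \<Rightarrow> (nat \<Rightarrow> nat \<Rightarrow> complex) \<Rightarrow> (nat \<Rightarrow> nat \<Rightarrow> complex) \<Rightarrow> (nat \<Rightarrow> real)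
    \<Rightarrow> (nat \<Rightarrow> nat \<Rightarrow> complex) \<Rightarrow> (nat \<Rightarrow> nat \<Rightarrow> complex) \<Rightarrow> (nat \<Rightarrow> real) \<Rightarrow> nat \<Rightarrow> nat \<Rightarrow> real" where
  "svd_overlap d a b m c e n i j =
    ((cmod (cinner d (b i) (e j)))\<^sup>2 + (cmod (cinner d (a i) (c j)))\<^sup>2) / 2 * ((m i)\<^sup>2 + (n j)\<^sup>2)
    - 2 * (m i * n j * Re (cinner d (b i) (e j) * cinner d (c j) (a i)))"

lemma Re_cinner_swap:
  "Re (cinner d x y * cinner d z w) = Re (cinner d w z * cinner d y x)"
proof -
  have "cinner d x y * cinner d z w = cnj (cinner d w z * cinner d y x)"
    by (simp add: cnj_cinner mult.commute)
  then show ?thesis by (simp only: complex_cnj cnj.sel)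
qed

lemma svd_overlap_commute: "svd_overlap d a b m c e n i j = svd_overlap d c e n a b m j i"
  unfolding svd_overlap_def Re_cinner_swap[of d "b i" "e j" "c j" "a i"]
    norm_cinner_commute[of d "b i" "e j"] norm_cinner_commute[of d "a i" "c j"]
  by (simp only: mult.commute add.commute)

lemma svd_overlap_sum_le:
  assumes M: "svd d M a b m" and N: "svd d N c e n" and Z: "svd d Z za zb z"
    and Z_eq: "Z = (\<lambda>r k. M r k - N r k) \<or> Z = (\<lambda>r k. N r k - M r k)"
    and p: "p \<ge> 2" and P: "P \<ge> 0" "(\<Sum>i<d. m i powr p) = P powr p"
    and R: "R \<ge> 0" "(\<Sum>i<d. z i powr p) = R powr p"
  shows "(\<Sum>i<d. m i powr (p - 2) * (\<Sum>j<d. svd_overlap d a b m c e n i j)) \<le> P powr (p - 2) * R\<^sup>2"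
proof -
  have a: "onb d a" and b: "onb d b" and m: "\<And>k. k < d \<Longrightarrow> 0 \<le> m k" using M by (auto simp: svd_def)
  have sgn: "sqnorm d (\<lambda>r. x r - y r) = sqnorm d (\<lambda>r. y r - x r)" for x y
    by (simp add: sqnorm_def norm_minus_commute)
  have adj_diff: "adj (\<lambda>r k. X r k - Y r k) = (\<lambda>r k. adj X r k - adj Y r k)" for X Y
    by (simp add: adj_def)
  have Za: "sqnorm d (mvec d Z x) = sqnorm d (mvec d (\<lambda>r k. M r k - N r k) x)"
    and Zb: "sqnorm d (mvec d (adj Z) x) = sqnorm d (mvec d (\<lambda>r k. adj M r k - adj N r k) x)" for x
    using Z_eq sgn[of "mvec d M x" "mvec d N x"] sgn[of "mvec d (adj M) x" "mvec d (adj N) x"]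
    by (auto simp: mvec_diff adj_diff)
  have ov: "(\<Sum>j<d. svd_overlap d a b m c e n i j)
      = (sqnorm d (mvec d Z (a i)) + sqnorm d (mvec d (adj Z) (b i))) / 2" if i: "i < d" for i
    unfolding Za Zb svd_sqnorm_diff[OF M N i] svd_sqnorm_diff[OF svd_adj[OF M] svd_adj[OF N] i]
      Re_cinner_swap[of d "a i" _ _ "b i"] sum.distrib[symmetric] sum_divide_distrib
    by (intro sum.cong refl) (simp add: svd_overlap_def field_simps)
  have 1: "(\<Sum>i<d. m i powr (p - 2) * sqnorm d (mvec d Z (a i))) \<le> P powr (p - 2) * R\<^sup>2"
    using svd_columns_le[OF Z a p] p P R m by (intro Holder_sum_powr) auto
  have 2: "(\<Sum>i<d. m i powr (p - 2) * sqnorm d (mvec d (adj Z) (b i))) \<le> P powr (p - 2) * R\<^sup>2"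
    using svd_columns_le[OF svd_adj[OF Z] b p] p P R m by (intro Holder_sum_powr) auto
  have "(\<Sum>i<d. m i powr (p - 2) * (\<Sum>j<d. svd_overlap d a b m c e n i j))
    = ((\<Sum>i<d. m i powr (p - 2) * sqnorm d (mvec d Z (a i))) + (\<Sum>i<d. m i powr (p - 2) * sqnorm d (mvec d (adj Z) (b i)))) / 2"
    unfolding sum.distrib[symmetric] sum_divide_distrib
    by (intro sum.cong refl) (simp add: ov field_simps)
  then show ?thesis using 1 2 by simp
qed

text \<open>\<open>svd_tangent\<close> at both endpoints bounds the second difference by a double
  sum. It separates into difference and sum terms with nonnegative weights, which the scalar bounds
  recombine into multiples of \<open>svd_overlap\<close>.\<close>

lemma svd_smoothness:
  assumes M: "svd d M a b m" and N: "svd d N c e n" and X: "svd d (\<lambda>r k. (M r k + N r k) / 2) xa xb x"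
    and Z: "svd d (\<lambda>r k. M r k - N r k) za zb z"
    and p: "p \<ge> 2" and P: "P \<ge> 0" "(\<Sum>i<d. m i powr p) = P powr p"
    and Q: "Q \<ge> 0" "(\<Sum>i<d. n i powr p) = Q powr p"
    and R: "R \<ge> 0" "(\<Sum>i<d. z i powr p) = R powr p"
  shows "P powr p + Q powr p - 2 * (\<Sum>i<d. x i powr p)
    \<le> p / 2 * (p - 1) * ((P powr (p - 2) + Q powr (p - 2)) * R\<^sup>2)"
proof -
  have a: "onb d a" and b: "onb d b" and m: "\<And>k. k < d \<Longrightarrow> 0 \<le> m k" using M by (auto simp: svd_def)
  have c: "onb d c" and e: "onb d e" and n: "\<And>k. k < d \<Longrightarrow> 0 \<le> n k" using N by (auto simp: svd_def)
  have X': "svd d (\<lambda>r k. (N r k + M r k) / 2) xa xb x" using X by (simp add: add.commute)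
  define \<gamma> where "\<gamma> = (\<lambda>i j. ((cmod (cinner d (b i) (e j)))\<^sup>2 + (cmod (cinner d (a i) (c j)))\<^sup>2) / 2)"
  define \<epsilon> where "\<epsilon> = (\<lambda>i j. Re (cinner d (b i) (e j) * cinner d (c j) (a i)))"
  have \<gamma>1: "(\<Sum>j<d. \<gamma> i j) = 1" if "i < d" for i
    using onb_sum_right[OF b e that] onb_sum_right[OF a c that]
    by (simp add: \<gamma>_def sum.distrib flip: sum_divide_distrib)
  have \<gamma>2: "(\<Sum>i<d. \<gamma> i j) = 1" if "j < d" for j
    using onb_sum_left[OF b e that] onb_sum_left[OF a c that]
    by (simp add: \<gamma>_def sum.distrib flip: sum_divide_distrib)
  have overlap: "svd_overlap d a b m c e n i j = \<gamma> i j * ((m i)\<^sup>2 + (n j)\<^sup>2) - 2 * (m i * n j * \<epsilon> i j)" for i j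
    by (simp only: svd_overlap_def \<gamma>_def \<epsilon>_def)
  \<comment> \<open>This makes both weights \<open>(\<gamma> i j + \<epsilon> i j) / 2\<close> and
    \<open>(\<gamma> i j - \<epsilon> i j) / 2\<close> nonnegative.\<close>
  have \<epsilon>\<gamma>: "\<bar>\<epsilon> i j\<bar> \<le> \<gamma> i j" for i j
  proof -
    have "\<bar>\<epsilon> i j\<bar> \<le> cmod (cinner d (b i) (e j)) * cmod (cinner d (a i) (c j))"
      unfolding \<epsilon>_def using abs_Re_le_cmod[of "cinner d (b i) (e j) * cinner d (c j) (a i)"]
      by (simp add: norm_mult norm_cinner_commute[of d "c j"])
    also have "\<dots> \<le> \<gamma> i j"
      using sum_squares_bound[of "cmod (cinner d (b i) (e j))" "cmod (cinner d (a i) (c j))"]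
      by (simp add: \<gamma>_def)
    finally show ?thesis .
  qed
  define B1 where "B1 = (\<Sum>i<d. m i powr (p - 1) * (m i - (\<Sum>j<d. n j * \<epsilon> i j)))"
  define B2 where "B2 = (\<Sum>j<d. n j powr (p - 1) * (n j - (\<Sum>i<d. m i * \<epsilon> i j)))"
  have "P powr p - (\<Sum>i<d. x i powr p) \<le> p / 2 * B1"
    using svd_tangent[OF M N X, of p] p P by (simp add: B1_def \<epsilon>_def)
  moreover have "Q powr p - (\<Sum>i<d. x i powr p) \<le> p / 2 * B2"
    using svd_tangent[OF N M X', of p] p Q unfolding Re_cinner_swap[of d "e _" "b _"]
    by (simp add: B2_def \<epsilon>_def mult.commute)
  ultimately have "P powr p + Q powr p - 2 * (\<Sum>i<d. x i powr p) \<le> p / 2 * (B1 + B2)"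
    by (simp add: algebra_simps)
  also have "\<dots> \<le> p / 2 * ((p - 1) * ((P powr (p - 2) + Q powr (p - 2)) * R\<^sup>2))"
  proof (intro mult_left_mono)
    \<comment> \<open>Unit row sums of \<open>\<gamma>\<close> spread \<open>m i\<close> over
      \<open>j\<close>; unit column sums do the same for \<open>n j\<close> in
      \<open>B2\<close>.\<close>
    have B1: "B1 = (\<Sum>i<d. \<Sum>j<d. m i powr (p - 1) * (\<gamma> i j * m i - n j * \<epsilon> i j))"
      unfolding B1_def
    proof (intro sum.cong refl)
      fix i assume "i \<in> {..<d}"
      then have "m i - (\<Sum>j<d. n j * \<epsilon> i j) = (\<Sum>j<d. \<gamma> i j * m i - n j * \<epsilon> i j)"
        by (simp add: sum_subtractf \<gamma>1 flip: sum_distrib_right)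
      then show "m i powr (p - 1) * (m i - (\<Sum>j<d. n j * \<epsilon> i j))
          = (\<Sum>j<d. m i powr (p - 1) * (\<gamma> i j * m i - n j * \<epsilon> i j))" by (simp only: sum_distrib_left)
    qed
    have B2: "B2 = (\<Sum>i<d. \<Sum>j<d. n j powr (p - 1) * (\<gamma> i j * n j - m i * \<epsilon> i j))"
      unfolding B2_def
    proof (subst sum.swap, intro sum.cong refl)
      fix j assume "j \<in> {..<d}"
      then have "n j - (\<Sum>i<d. m i * \<epsilon> i j) = (\<Sum>i<d. \<gamma> i j * n j - m i * \<epsilon> i j)"
        by (simp add: sum_subtractf \<gamma>2 flip: sum_distrib_right)
      then show "n j powr (p - 1) * (n j - (\<Sum>i<d. m i * \<epsilon> i j))
          = (\<Sum>i<d. n j powr (p - 1) * (\<gamma> i j * n j - m i * \<epsilon> i j))" by (simp only: sum_distrib_left)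
    qed
    \<comment> \<open>Regrouping: \<open>\<gamma>\<close> multiplies the mean of the two products
      and \<open>\<epsilon>\<close> half of their difference.\<close>
    have "B1 + B2 = (\<Sum>i<d. \<Sum>j<d. (\<gamma> i j + \<epsilon> i j) / 2 * ((m i powr (p - 1) - n j powr (p - 1)) * (m i - n j))
        + (\<gamma> i j - \<epsilon> i j) / 2 * ((m i powr (p - 1) + n j powr (p - 1)) * (m i + n j)))"
      unfolding B1 B2 sum.distrib[symmetric] by (intro sum.cong refl) (simp add: field_simps)
    also have "\<dots> \<le> (\<Sum>i<d. \<Sum>j<d. (p - 1) * ((m i powr (p - 2) + n j powr (p - 2)) * svd_overlap d a b m c e n i j))"
    proof (intro sum_mono)
      fix i j assume "i \<in> {..<d}" "j \<in> {..<d}"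
      then have ij: "0 \<le> m i" "0 \<le> n j" using m n by auto
      have "(\<gamma> i j + \<epsilon> i j) / 2 * ((m i powr (p - 1) - n j powr (p - 1)) * (m i - n j))
        + (\<gamma> i j - \<epsilon> i j) / 2 * ((m i powr (p - 1) + n j powr (p - 1)) * (m i + n j))
        \<le> (\<gamma> i j + \<epsilon> i j) / 2 * ((p - 1) * ((m i powr (p - 2) + n j powr (p - 2)) * (m i - n j)\<^sup>2))
        + (\<gamma> i j - \<epsilon> i j) / 2 * ((p - 1) * ((m i powr (p - 2) + n j powr (p - 2)) * (m i + n j)\<^sup>2))"
        using \<epsilon>\<gamma>[of i j] p ij by (intro add_mono mult_left_mono powr_diff_mult_le powr_add_mult_le) auto
      also have "\<dots> = (p - 1) * ((m i powr (p - 2) + n j powr (p - 2))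
          * ((\<gamma> i j + \<epsilon> i j) / 2 * (m i - n j)\<^sup>2 + (\<gamma> i j - \<epsilon> i j) / 2 * (m i + n j)\<^sup>2))"
        by (simp only: distrib_left mult.left_commute)
      also have "(\<gamma> i j + \<epsilon> i j) / 2 * (m i - n j)\<^sup>2 + (\<gamma> i j - \<epsilon> i j) / 2 * (m i + n j)\<^sup>2
          = svd_overlap d a b m c e n i j"
        unfolding overlap by (simp add: power2_eq_square field_simps)
      finally show "(\<gamma> i j + \<epsilon> i j) / 2 * ((m i powr (p - 1) - n j powr (p - 1)) * (m i - n j))
        + (\<gamma> i j - \<epsilon> i j) / 2 * ((m i powr (p - 1) + n j powr (p - 1)) * (m i + n j))
        \<le> (p - 1) * ((m i powr (p - 2) + n j powr (p - 2)) * svd_overlap d a b m c e n i j)" .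
    qed
    also have "\<dots> = (p - 1) * ((\<Sum>i<d. \<Sum>j<d. m i powr (p - 2) * svd_overlap d a b m c e n i j)
        + (\<Sum>i<d. \<Sum>j<d. n j powr (p - 2) * svd_overlap d a b m c e n i j))"
      by (simp only: distrib_right sum.distrib sum_distrib_left[symmetric])
    also have "(\<Sum>i<d. \<Sum>j<d. n j powr (p - 2) * svd_overlap d a b m c e n i j)
        = (\<Sum>j<d. n j powr (p - 2) * (\<Sum>i<d. svd_overlap d c e n a b m j i))"
      by (subst sum.swap) (simp add: sum_distrib_left svd_overlap_commute[of d a b m])
    also have "(\<Sum>i<d. \<Sum>j<d. m i powr (p - 2) * svd_overlap d a b m c e n i j)
        = (\<Sum>i<d. m i powr (p - 2) * (\<Sum>j<d. svd_overlap d a b m c e n i j))"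
      by (simp add: sum_distrib_left)
    also have "(p - 1) * ((\<Sum>i<d. m i powr (p - 2) * (\<Sum>j<d. svd_overlap d a b m c e n i j))
        + (\<Sum>j<d. n j powr (p - 2) * (\<Sum>i<d. svd_overlap d c e n a b m j i)))
      \<le> (p - 1) * (P powr (p - 2) * R\<^sup>2 + Q powr (p - 2) * R\<^sup>2)"
      using p by (intro mult_left_mono add_mono svd_overlap_sum_le[OF M N Z _ p P R] svd_overlap_sum_le[OF N M Z _ p Q R]) auto
    finally show "B1 + B2 \<le> (p - 1) * ((P powr (p - 2) + Q powr (p - 2)) * R\<^sup>2)"
      by (simp add: distrib_right)
  qed (use p in auto)
  finally show ?thesis by (simp add: mult.assoc)
qed

section \<open>The Schatten norm\<close>

definition pnorm :: "real \<Rightarrow> nat \<Rightarrow> (nat \<Rightarrow> nat \<Rightarrow> complex) \<Rightarrow> real" where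
  "pnorm p d X = schatten_norm p (mat d d (\<lambda>(r, c). X r c))"

lemma pnorm_cong: "(\<And>r c. r < d \<Longrightarrow> c < d \<Longrightarrow> X r c = Y r c) \<Longrightarrow> pnorm p d X = pnorm p d Y"
  unfolding pnorm_def by (intro arg_cong[where f = "schatten_norm p"] eq_matI) auto

lemma pnorm_nonneg [simp]: "0 \<le> pnorm p d X"
  by (simp add: pnorm_def schatten_norm_def)

lemma ex_svd_pnorm:
  "\<exists>a b s. svd d X a b s \<and> (\<forall>p>0. pnorm p d X powr p = (\<Sum>k<d. s k powr p))"
proof -
  obtain a b s where *: "svd d X a b s"
    "singular_values (mat d d (\<lambda>(r, c). X r c)) = image_mset s (mset_set {..<d})"
    using ex_svd_singular_values by blast
  have "pnorm p d X powr p = (\<Sum>k<d. s k powr p)" if "p > 0" for p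
    using that by (simp add: pnorm_def schatten_norm_def *(2) multiset.map_comp o_def powr_powr
      sum_nonneg flip: sum_unfold_sum_mset)
  with *(1) show ?thesis by blast
qed

lemma pnorm_diagonal_le:
  assumes "onb d u" "onb d v" "p \<ge> 1"
  shows "(\<Sum>i<d. cmod (cinner d (v i) (mvec d X (u i))) powr p) \<le> pnorm p d X powr p"
proof -
  obtain a b s where *: "svd d X a b s" "\<forall>p>0. pnorm p d X powr p = (\<Sum>k<d. s k powr p)"
    using ex_svd_pnorm by blast
  show ?thesis using svd_diagonal_le[OF *(1) assms] *(2) assms(3) by simp
qed

lemma ex_pnorm_diagonal_eq:
  assumes "p > 0"
  shows "\<exists>u v. onb d u \<and> onb d v \<and> pnorm p d X powr p = (\<Sum>i<d. cmod (cinner d (v i) (mvec d X (u i))) powr p)"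
proof -
  obtain a b s where *: "svd d X a b s" "\<forall>p>0. pnorm p d X powr p = (\<Sum>k<d. s k powr p)"
    using ex_svd_pnorm by blast
  then show ?thesis using svd_diagonal_eq[OF *(1), of p] assms
    by (intro exI[of _ a] exI[of _ b]) (simp add: svd_def)
qed

lemma powr_le_powr_imp_le:
  fixes x y p :: real
  assumes "x powr p \<le> y powr p" "p > 0" "0 \<le> y"
  shows "x \<le> y"
proof (rule ccontr)
  assume "\<not> x \<le> y"
  then have "y powr p < x powr p" using assms by (intro powr_less_mono2) auto
  then show False using assms(1) by simp
qed

text \<open>Bases attaining the norm of the combination are tested on every \<open>X i\<close>.
  Diagonal entries are linear in the matrix, scalar convexity applies to each, and
  \<open>pnorm_diagonal_le\<close> bounds the result.\<close>

lemma pnorm_powr_convex: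
  assumes "finite I" "\<And>i. i \<in> I \<Longrightarrow> 0 \<le> w i" "sum w I = 1" "p \<ge> 1"
  shows "pnorm p d (\<lambda>r c. \<Sum>i\<in>I. of_real (w i) * X i r c) powr p \<le> (\<Sum>i\<in>I. w i * pnorm p d (X i) powr p)"
proof -
  let ?S = "\<lambda>r c. \<Sum>i\<in>I. of_real (w i) * X i r c"
  have form: "cinner d y (mvec d ?S x) = (\<Sum>i\<in>I. of_real (w i) * cinner d y (mvec d (X i) x))" for x y
  proof -
    have "mvec d ?S x = (\<lambda>r. \<Sum>i\<in>I. of_real (w i) * mvec d (X i) x r)"
      unfolding mvec_def sum_distrib_right sum_distrib_left by (subst sum.swap) (simp add: mult_ac)
    then show ?thesis by (simp only: cinner_sum_right)
  qed
  obtain u v where uv: "onb d u" "onb d v"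
    and eq: "pnorm p d ?S powr p = (\<Sum>k<d. cmod (cinner d (v k) (mvec d ?S (u k))) powr p)"
    using ex_pnorm_diagonal_eq[of p d ?S] assms by auto
  have "pnorm p d ?S powr p \<le> (\<Sum>k<d. \<Sum>i\<in>I. w i * cmod (cinner d (v k) (mvec d (X i) (u k))) powr p)"
    unfolding eq
  proof (intro sum_mono)
    fix k
    have "cmod (cinner d (v k) (mvec d ?S (u k))) \<le> (\<Sum>i\<in>I. w i * cmod (cinner d (v k) (mvec d (X i) (u k))))"
      unfolding form using assms by (intro sum_norm_le) (simp add: norm_mult)
    then have "cmod (cinner d (v k) (mvec d ?S (u k))) powr p \<le> (\<Sum>i\<in>I. w i * cmod (cinner d (v k) (mvec d (X i) (u k)))) powr p"
      using assms by (intro powr_mono2) auto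
    also have "\<dots> \<le> (\<Sum>i\<in>I. w i * cmod (cinner d (v k) (mvec d (X i) (u k))) powr p)"
      using assms by (intro subconvex_sum_powr) auto
    finally show "cmod (cinner d (v k) (mvec d ?S (u k))) powr p \<le> \<dots>" .
  qed
  also have "\<dots> = (\<Sum>i\<in>I. w i * (\<Sum>k<d. cmod (cinner d (v k) (mvec d (X i) (u k))) powr p))"
    by (subst sum.swap) (simp add: sum_distrib_left)
  also have "\<dots> \<le> (\<Sum>i\<in>I. w i * pnorm p d (X i) powr p)"
    using assms uv by (intro sum_mono mult_left_mono pnorm_diagonal_le) auto
  finally show ?thesis .
qed

lemma pnorm_scale_le:
  assumes "p \<ge> 1"
  shows "pnorm p d (\<lambda>r c. g * X r c) \<le> cmod g * pnorm p d X"
proof -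
  let ?S = "\<lambda>r c. g * X r c"
  obtain u v where uv: "onb d u" "onb d v"
    and eq: "pnorm p d ?S powr p = (\<Sum>k<d. cmod (cinner d (v k) (mvec d ?S (u k))) powr p)"
    using ex_pnorm_diagonal_eq[of p d ?S] assms by auto
  have form: "cinner d y (mvec d ?S x) = g * cinner d y (mvec d X x)" for x y
    by (simp add: cinner_def mvec_def sum_distrib_left mult_ac)
  have "pnorm p d ?S powr p = cmod g powr p * (\<Sum>k<d. cmod (cinner d (v k) (mvec d X (u k))) powr p)"
    unfolding eq form by (simp add: norm_mult powr_mult sum_distrib_left)
  also have "\<dots> \<le> cmod g powr p * pnorm p d X powr p"
    using assms uv by (intro mult_left_mono pnorm_diagonal_le) auto
  also have "\<dots> = (cmod g * pnorm p d X) powr p" by (simp add: powr_mult)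
  finally show ?thesis by (rule powr_le_powr_imp_le) (use assms in auto)
qed

text \<open>Convexity of the p-th power makes the unit ball convex, and the sum is
  \<open>a + b\<close> times a convex combination of \<open>X / a\<close> and \<open>Y / b\<close>,
  which lie in the ball.\<close>

lemma pnorm_add_le:
  assumes "p \<ge> 1"
  shows "pnorm p d (\<lambda>r c. X r c + Y r c) \<le> pnorm p d X + pnorm p d Y"
proof (rule field_le_epsilon)
  fix e :: real assume e: "e > 0"
  \<comment> \<open>The surplus \<open>e / 2\<close> keeps the scaling factors positive even when a
    norm vanishes.\<close>
  define a where "a = pnorm p d X + e / 2"
  define b where "b = pnorm p d Y + e / 2"
  have ab: "a > 0" "b > 0" using e pnorm_nonneg[of p d X] pnorm_nonneg[of p d Y]
    by (auto simp: a_def b_def intro: add_nonneg_pos)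
  define w where "w = (\<lambda>z. if z then a / (a + b) else b / (a + b))"
  define Z where "Z = (\<lambda>z r c. if z then of_real (1 / a) * X r c else of_real (1 / b) * Y r c)"
  let ?S = "\<lambda>r c. \<Sum>z\<in>UNIV. of_real (w z) * Z z r c"
  have "pnorm p d (Z z) \<le> 1" for z
  proof (cases z)
    case True
    then have "pnorm p d (Z z) \<le> 1 / a * pnorm p d X"
      using pnorm_scale_le[OF assms, of d "of_real (1 / a)" X] ab by (simp add: Z_def norm_divide)
    also have "\<dots> \<le> 1" using ab e by (simp add: a_def field_simps)
    finally show ?thesis .
  next
    case False
    then have "pnorm p d (Z z) \<le> 1 / b * pnorm p d Y"
      using pnorm_scale_le[OF assms, of d "of_real (1 / b)" Y] ab by (simp add: Z_def norm_divide)
    also have "\<dots> \<le> 1" using ab e by (simp add: b_def field_simps)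
    finally show ?thesis .
  qed
  then have Z: "pnorm p d (Z z) powr p \<le> 1" for z
    using assms powr_mono2[of p "pnorm p d (Z z)" 1] by simp
  have w: "0 \<le> w z" "sum w UNIV = 1" for z
    using ab by (auto simp: w_def UNIV_bool add.commute simp flip: add_divide_distrib)
  have "pnorm p d ?S powr p \<le> (\<Sum>z\<in>UNIV. w z * pnorm p d (Z z) powr p)"
    using assms w by (intro pnorm_powr_convex) auto
  also have "\<dots> \<le> (\<Sum>z\<in>UNIV. w z * 1)"
    using w Z by (intro sum_mono mult_left_mono) auto
  also have "\<dots> = 1 powr p" using w(2) by simp
  finally have S: "pnorm p d ?S \<le> 1"
    by (rule powr_le_powr_imp_le) (use assms in auto)
  have "pnorm p d (\<lambda>r c. X r c + Y r c) = pnorm p d (\<lambda>r c. of_real (a + b) * ?S r c)"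
  proof (rule pnorm_cong)
    fix r c
    have e: "of_real (a + b) * (of_real (a / (a + b)) * (of_real (1 / a) * X r c)) = of_real ((a + b) * (a / (a + b)) * (1 / a)) * X r c"
      "of_real (a + b) * (of_real (b / (a + b)) * (of_real (1 / b) * Y r c)) = of_real ((a + b) * (b / (a + b)) * (1 / b)) * Y r c"
      by (simp_all only: of_real_mult mult.assoc)
    have one: "(a + b) * (a / (a + b)) * (1 / a) = 1" "(a + b) * (b / (a + b)) * (1 / b) = 1"
      using ab by (simp_all add: add_nonneg_eq_0_iff)
    have "of_real (a + b) * ?S r c = of_real (a + b) * (of_real (b / (a + b)) * (of_real (1 / b) * Y r c))
        + of_real (a + b) * (of_real (a / (a + b)) * (of_real (1 / a) * X r c))"
      by (simp add: UNIV_bool w_def Z_def distrib_left del: of_real_add of_real_divide)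
    then show "X r c + Y r c = of_real (a + b) * ?S r c" unfolding e one by simp
  qed
  also have "\<dots> \<le> cmod (of_real (a + b)) * pnorm p d ?S" by (rule pnorm_scale_le[OF assms])
  also have "\<dots> \<le> (a + b) * 1" unfolding norm_of_real using ab S by (intro mult_mono) auto
  finally show "pnorm p d (\<lambda>r c. X r c + Y r c) \<le> pnorm p d X + pnorm p d Y + e"
    by (simp add: a_def b_def)
qed

lemma pnorm_diff_le:
  assumes "p \<ge> 1"
  shows "pnorm p d (\<lambda>r c. X r c - Y r c) \<le> pnorm p d X + pnorm p d Y"
proof -
  have "pnorm p d (\<lambda>r c. X r c - Y r c) = pnorm p d (\<lambda>r c. X r c + (-1) * Y r c)" by simp
  also have "\<dots> \<le> pnorm p d X + pnorm p d (\<lambda>r c. (-1) * Y r c)" by (rule pnorm_add_le[OF assms])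
  also have "\<dots> \<le> pnorm p d X + cmod (-1) * pnorm p d Y" by (intro add_left_mono pnorm_scale_le assms)
  finally show ?thesis by simp
qed

lemma pnorm_Clarkson:
  assumes "0 < p" "p \<le> 2"
  shows "pnorm p d (\<lambda>r c. X r c + Y r c) powr p + pnorm p d (\<lambda>r c. X r c - Y r c) powr p
    \<le> 2 * (pnorm p d X powr p + pnorm p d Y powr p)"
proof -
  obtain a b s where X: "svd d X a b s" "\<forall>p>0. pnorm p d X powr p = (\<Sum>k<d. s k powr p)"
    using ex_svd_pnorm by blast
  obtain a' b' t where Y: "svd d Y a' b' t" "\<forall>p>0. pnorm p d Y powr p = (\<Sum>k<d. t k powr p)"
    using ex_svd_pnorm by blast
  obtain aP bP x where P: "svd d (\<lambda>r c. X r c + Y r c) aP bP x"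
    "\<forall>p>0. pnorm p d (\<lambda>r c. X r c + Y r c) powr p = (\<Sum>k<d. x k powr p)"
    using ex_svd_pnorm by blast
  obtain aQ bQ y where Q: "svd d (\<lambda>r c. X r c - Y r c) aQ bQ y"
    "\<forall>p>0. pnorm p d (\<lambda>r c. X r c - Y r c) powr p = (\<Sum>k<d. y k powr p)"
    using ex_svd_pnorm by blast
  show ?thesis using svd_Clarkson[OF X(1) Y(1) P(1) Q(1) assms] X(2) Y(2) P(2) Q(2) assms by simp
qed

lemma pnorm_smoothness:
  assumes p: "p \<ge> 2"
  shows "pnorm p d (\<lambda>r c. X r c + Y r c) powr p + pnorm p d (\<lambda>r c. X r c - Y r c) powr p
    \<le> 2 * pnorm p d X powr p + 2 * p * (p - 1) *
      ((pnorm p d (\<lambda>r c. X r c + Y r c) powr (p - 2) + pnorm p d (\<lambda>r c. X r c - Y r c) powr (p - 2)) * (pnorm p d Y)\<^sup>2)"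
proof -
  let ?M = "\<lambda>r c. X r c + Y r c" and ?N = "\<lambda>r c. X r c - Y r c"
  let ?Z = "\<lambda>r c. ?M r c - ?N r c"
  have mid: "(\<lambda>r c. (?M r c + ?N r c) / 2) = X" by (simp add: fun_eq_iff)
  obtain a b m where M: "svd d ?M a b m" "\<forall>p>0. pnorm p d ?M powr p = (\<Sum>k<d. m k powr p)"
    using ex_svd_pnorm by blast
  obtain c e n where N: "svd d ?N c e n" "\<forall>p>0. pnorm p d ?N powr p = (\<Sum>k<d. n k powr p)"
    using ex_svd_pnorm by blast
  obtain xa xb x where X: "svd d X xa xb x" "\<forall>p>0. pnorm p d X powr p = (\<Sum>k<d. x k powr p)"
    using ex_svd_pnorm by blast
  obtain za zb z where Z: "svd d ?Z za zb z" "\<forall>p>0. pnorm p d ?Z powr p = (\<Sum>k<d. z k powr p)"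
    using ex_svd_pnorm by blast
  have "pnorm p d ?M powr p + pnorm p d ?N powr p - 2 * (\<Sum>i<d. x i powr p)
    \<le> p / 2 * (p - 1) * ((pnorm p d ?M powr (p - 2) + pnorm p d ?N powr (p - 2)) * (pnorm p d ?Z)\<^sup>2)"
  proof (rule svd_smoothness[OF M(1) N(1) _ Z(1) p pnorm_nonneg _ pnorm_nonneg _ pnorm_nonneg])
    show "svd d (\<lambda>r c. (?M r c + ?N r c) / 2) xa xb x" unfolding mid by (rule X(1))
  qed (use M(2) N(2) Z(2) p in auto)
  \<comment> \<open>The endpoints differ by \<open>2 Y\<close>; the square supplies the 4 that turns
    \<open>p / 2\<close> into \<open>2 * p\<close>.\<close>
  also have "\<dots> \<le> p / 2 * (p - 1) * ((pnorm p d ?M powr (p - 2) + pnorm p d ?N powr (p - 2)) * (2 * pnorm p d Y)\<^sup>2)"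
  proof (intro mult_left_mono power_mono)
    have "pnorm p d ?Z = pnorm p d (\<lambda>r c. 2 * Y r c)" by (intro pnorm_cong) simp
    then show "pnorm p d ?Z \<le> 2 * pnorm p d Y" using pnorm_scale_le[of p d 2 Y] p by simp
  qed (use p in auto)
  also have "\<dots> = 2 * p * (p - 1) * ((pnorm p d ?M powr (p - 2) + pnorm p d ?N powr (p - 2)) * (pnorm p d Y)\<^sup>2)"
    by (simp add: power_mult_distrib)
  also have "(\<Sum>i<d. x i powr p) = pnorm p d X powr p" using X(2) p by simp
  finally show ?thesis by linarith
qed

lemma pnorm_zero:
  assumes "p \<ge> 1"
  shows "pnorm p d (\<lambda>r c. 0) = 0"
  using pnorm_scale_le[OF assms, of d 0 "\<lambda>r c. 0"] pnorm_nonneg[of p d "\<lambda>r c. 0"] by simp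

section \<open>Matrices as index functions, and the diameter\<close>

lemma schatten_norm_eq_pnorm:
  assumes "X \<in> carrier_mat d d"
  shows "schatten_norm p X = pnorm p d (\<lambda>r c. X $$ (r, c))"
proof -
  have "X = mat d d (\<lambda>(r, c). X $$ (r, c))" using assms by (intro eq_matI) auto
  then show ?thesis unfolding pnorm_def by (rule arg_cong)
qed

lemma schatten_norm_diff_eq_pnorm:
  assumes "X \<in> carrier_mat d d" "Y \<in> carrier_mat d d"
  shows "schatten_norm p (X - Y) = pnorm p d (\<lambda>r c. X $$ (r, c) - Y $$ (r, c))"
proof -
  have "X - Y \<in> carrier_mat d d" using assms by auto
  then have "schatten_norm p (X - Y) = pnorm p d (\<lambda>r c. (X - Y) $$ (r, c))" by (rule schatten_norm_eq_pnorm)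
  also have "\<dots> = pnorm p d (\<lambda>r c. X $$ (r, c) - Y $$ (r, c))" using assms by (intro pnorm_cong) auto
  finally show ?thesis .
qed

text \<open>Boundedness enters here: a real supremum controls its members only for a set bounded
  above, and twice a bound for \<open>S\<close> bounds all differences.\<close>

lemma schatten_norm_diff_le_diam:
  assumes S: "S \<subseteq> carrier_mat d d" and bdd: "\<exists>M. \<forall>X\<in>S. schatten_norm p X \<le> M" and p: "p \<ge> 1"
    and XY: "X \<in> S" "Y \<in> S"
  shows "schatten_norm p (X - Y) \<le> schatten_diam p S"
proof -
  obtain M where M: "\<And>X. X \<in> S \<Longrightarrow> schatten_norm p X \<le> M" using bdd by blast
  have "schatten_norm p (X - Y) \<le> M + M" if "X \<in> S" "Y \<in> S" for X Y
  proof -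
    have c: "X \<in> carrier_mat d d" "Y \<in> carrier_mat d d" using that S by auto
    have "schatten_norm p (X - Y) \<le> schatten_norm p X + schatten_norm p Y"
      unfolding schatten_norm_diff_eq_pnorm[OF c] c[THEN schatten_norm_eq_pnorm] by (rule pnorm_diff_le[OF p])
    then show ?thesis using M[OF that(1)] M[OF that(2)] by linarith
  qed
  then have "bdd_above {schatten_norm p (X - Y) | X Y. X \<in> S \<and> Y \<in> S}"
    by (intro bdd_aboveI[of _ "M + M"]) blast
  then show ?thesis unfolding schatten_diam_def using XY by (intro cSup_upper) blast
qed

section \<open>Greedy approximation\<close>

text \<open>If every \<open>Y i\<close> raised the p-th power by more than \<open>K\<close>, the
  two-point bound would make every \<open>E - Y i\<close> strictly shorter than \<open>E\<close>.
  But \<open>E\<close> is a convex combination of these, which contradicts convexity.\<close>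

lemma greedy_step:
  fixes w :: "nat \<Rightarrow> real"
  assumes w: "\<And>i. i < n \<Longrightarrow> 0 \<le> w i" "(\<Sum>i<n. w i) = 1" and p: "p \<ge> 1"
    and Y: "\<And>r c. r < d \<Longrightarrow> c < d \<Longrightarrow> (\<Sum>i<n. of_real (w i) * Y i r c) = 0"
    and K: "\<And>i. i < n \<Longrightarrow> pnorm p d (\<lambda>r c. E r c + Y i r c) powr p + pnorm p d (\<lambda>r c. E r c - Y i r c) powr p
      \<le> 2 * pnorm p d E powr p + K"
  shows "\<exists>i<n. pnorm p d (\<lambda>r c. E r c + Y i r c) powr p \<le> pnorm p d E powr p + K"
proof (rule ccontr)
  assume "\<not> ?thesis"
  then have neg: "pnorm p d (\<lambda>r c. E r c + Y i r c) powr p > pnorm p d E powr p + K" if "i < n" for i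
    using that by (meson not_le)
  have lt: "pnorm p d (\<lambda>r c. E r c - Y i r c) powr p < pnorm p d E powr p" if "i < n" for i
    using K[OF that] neg[OF that] by simp
  \<comment> \<open>Strictness must occur at an index of positive weight.\<close>
  obtain j where j: "j < n" "w j > 0"
  proof -
    have "\<exists>j<n. w j \<noteq> 0" using w(2) by (metis lessThan_iff sum.neutral zero_neq_one)
    then show ?thesis using that w(1) by (metis less_le)
  qed
  have "pnorm p d E = pnorm p d (\<lambda>r c. \<Sum>i<n. of_real (w i) * (E r c - Y i r c))"
  proof (rule pnorm_cong)
    fix r c assume "r < d" "c < d"
    then show "E r c = (\<Sum>i<n. of_real (w i) * (E r c - Y i r c))"
      using Y[of r c] w(2) by (simp add: right_diff_distrib sum_subtractf flip: sum_distrib_right of_real_sum)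
  qed
  then have "pnorm p d E powr p \<le> (\<Sum>i<n. w i * pnorm p d (\<lambda>r c. E r c - Y i r c) powr p)"
    using pnorm_powr_convex[of "{..<n}" w p d "\<lambda>i r c. E r c - Y i r c"] w p by simp
  also have "\<dots> < (\<Sum>i<n. w i * pnorm p d E powr p)"
  proof (rule sum_strict_mono_ex1)
    show "\<forall>i\<in>{..<n}. w i * pnorm p d (\<lambda>r c. E r c - Y i r c) powr p \<le> w i * pnorm p d E powr p"
      using w(1) lt by (simp add: less_imp_le mult_left_mono)
    show "\<exists>i\<in>{..<n}. w i * pnorm p d (\<lambda>r c. E r c - Y i r c) powr p < w i * pnorm p d E powr p"
      using lt j by (intro bexI[of _ j]) auto
  qed simp
  also have "\<dots> = pnorm p d E powr p" using w(2) by (simp flip: sum_distrib_right)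
  finally show False by simp
qed

text \<open>Up to about \<open>C * (p - 1)\<close> steps the linear bound \<open>D * k\<close> lies
  below the claimed root. Later \<open>B >= p - 1\<close>, so adding \<open>D\<close> costs at most
  a factor \<open>exp 1\<close> in the power \<open>p - 2\<close>, and the tangent to
  \<open>t powr (p / 2)\<close> absorbs the increment. The threshold \<open>8 * exp 1\<close> is
  \<open>4 * p * (p - 1) * exp 1\<close> divided by \<open>p / 2 * (p - 1)\<close>.\<close>

lemma smooth_growth:
  fixes a :: "nat \<Rightarrow> real"
  assumes p: "p \<ge> 2" and D: "D \<ge> 0" and a0: "a 0 = 0" and a: "\<And>k. 0 \<le> a k"
    and lin: "\<And>k. a (Suc k) \<le> a k + D"
    and step: "\<And>k. a (Suc k) powr p \<le> a k powr p + 4 * p * (p - 1) * ((a k + D) powr (p - 2) * D\<^sup>2)"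
    and C: "C \<ge> 8 * exp 1"
  shows "a k \<le> D * sqrt (C * (p - 1) * k)"
proof (induction k)
  case (Suc k)
  have C1: "C \<ge> 8" using C exp_ge_add_one_self[of 1] by linarith
  have triv: "a k \<le> D * k" for k
  proof (induction k)
    case (Suc k)
    then show ?case using lin[of k] by (simp add: algebra_simps)
  qed (simp add: a0)
  show ?case
  proof (cases "D = 0 \<or> real (Suc k) \<le> C * (p - 1)")
    case True
    have "D * real (Suc k) \<le> D * sqrt (C * (p - 1) * Suc k)"
    proof (cases "D = 0")
      case False
      with True have "real (Suc k) \<le> C * (p - 1)" by blast
      then have "real (Suc k) * real (Suc k) \<le> C * (p - 1) * real (Suc k)"
        by (rule mult_right_mono) simp
      then have "real (Suc k) \<le> sqrt (C * (p - 1) * real (Suc k))"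
        by (intro real_le_rsqrt) (simp only: power2_eq_square)
      then show ?thesis using D by (rule mult_left_mono)
    qed simp
    then show ?thesis using triv[of "Suc k"] by linarith
  next
    case False
    then have Dpos: "D > 0" and k: "real k > C * (p - 1) - 1" using D by auto
    define B where "B = sqrt (C * (p - 1) * k)"
    \<comment> \<open>The 1 lost between \<open>k\<close> and \<open>Suc k\<close> is absorbed
      because \<open>p - 1 >= 1\<close>.\<close>
    have "1 * (p - 1) \<le> (C - 1) * (p - 1)" using C1 p by (intro mult_right_mono) auto
    then have kp: "real k \<ge> p - 1" using k p by (simp add: algebra_simps)
    have Cp: "C * (p - 1) \<ge> p - 1" using C1 p by (simp add: mult_le_cancel_right1)
    have Bsq: "B\<^sup>2 = C * (p - 1) * k" using C1 p by (simp add: B_def)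
    have "(p - 1) * (p - 1) \<le> C * (p - 1) * k" using kp Cp p by (intro mult_mono) auto
    then have B: "B \<ge> p - 1" unfolding B_def by (intro real_le_rsqrt) (simp add: power2_eq_square)
    then have Bpos: "B > 0" using p by linarith
    have "(B + 1) powr (p - 2) \<le> B powr (p - 2) * exp 1"
    proof -
      have "B + 1 = B * (1 + 1 / B)" using Bpos by (simp add: field_simps)
      then have "(B + 1) powr (p - 2) = B powr (p - 2) * (1 + 1 / B) powr (p - 2)"
        using Bpos by (metis powr_mult)
      moreover have "(1 + 1 / B) powr (p - 2) \<le> exp 1"
      proof -
        have "(1 + 1 / B) powr (p - 2) \<le> exp (1 / B) powr (p - 2)"
          using Bpos p by (intro powr_mono2) auto
        also have "\<dots> = exp ((p - 2) / B)" by (simp add: powr_def)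
        also have "\<dots> \<le> exp 1" using B Bpos by simp
        finally show ?thesis .
      qed
      ultimately show ?thesis by (simp only:) (rule mult_left_mono, auto)
    qed
    then have "4 * p * (p - 1) * (B + 1) powr (p - 2) \<le> 4 * p * (p - 1) * (B powr (p - 2) * exp 1)"
      using p by (intro mult_left_mono) auto
    also have "\<dots> = p / 2 * (p - 1) * B powr (p - 2) * (8 * exp 1)" by simp
    also have "\<dots> \<le> p / 2 * (p - 1) * B powr (p - 2) * C" using C p by (intro mult_left_mono) auto
    finally have incr: "4 * p * (p - 1) * (B + 1) powr (p - 2) \<le> p / 2 * (p - 1) * B powr (p - 2) * C" .
    have akB: "a k \<le> B * D" using Suc by (simp add: B_def mult.commute)
    have "a (Suc k) powr p \<le> a k powr p + 4 * p * (p - 1) * ((a k + D) powr (p - 2) * D\<^sup>2)" by (rule step)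
    also have "\<dots> \<le> (B * D) powr p + 4 * p * (p - 1) * ((B * D + D) powr (p - 2) * D\<^sup>2)"
      using akB a[of k] D p by (intro add_mono mult_left_mono mult_right_mono powr_mono2) auto
    also have "(B * D + D) powr (p - 2) * D\<^sup>2 = (B + 1) powr (p - 2) * D powr p"
    proof -
      have "(B * D + D) powr (p - 2) = (B + 1) powr (p - 2) * D powr (p - 2)"
        using Bpos Dpos by (simp add: distrib_right flip: powr_mult)
      moreover have "D powr (p - 2) * D\<^sup>2 = D powr p" using Dpos by (simp add: powr_diff)
      ultimately show ?thesis by (simp add: mult.assoc)
    qed
    also have "(B * D) powr p + 4 * p * (p - 1) * ((B + 1) powr (p - 2) * D powr p)
        = D powr p * (B powr p + 4 * p * (p - 1) * (B + 1) powr (p - 2))"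
      by (simp add: powr_mult algebra_simps)
    also have "\<dots> \<le> D powr p * (B powr p + p / 2 * (p - 1) * B powr (p - 2) * C)"
      using incr by (intro mult_left_mono add_left_mono) auto
    \<comment> \<open>The tangent to \<open>t powr (p / 2)\<close> at \<open>B^2\<close>, evaluated
      one step \<open>C * (p - 1)\<close> further.\<close>
    also have "\<dots> \<le> D powr p * (C * (p - 1) * Suc k) powr (p / 2)"
    proof (intro mult_left_mono)
      have "(B\<^sup>2) powr (p / 2) + p / 2 * (B\<^sup>2) powr (p / 2 - 1) * (C * (p - 1) * Suc k - B\<^sup>2)
          \<le> (C * (p - 1) * Suc k) powr (p / 2)"
        using p C1 by (intro powr_ge_tangent) auto
      moreover have "(B\<^sup>2) powr (p / 2) = B powr p" using Bpos by (simp add: powr_half_square)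
      moreover have "(B\<^sup>2) powr (p / 2 - 1) = B powr (p - 2)"
        using powr_half_square[of B "p - 2"] Bpos by (simp add: diff_divide_distrib)
      moreover have "C * (p - 1) * Suc k - B\<^sup>2 = C * (p - 1)" by (simp add: Bsq algebra_simps)
      ultimately show "B powr p + p / 2 * (p - 1) * B powr (p - 2) * C \<le> (C * (p - 1) * Suc k) powr (p / 2)"
        by (simp add: mult_ac)
    qed auto
    also have "\<dots> = (D * sqrt (C * (p - 1) * Suc k)) powr p"
      using p C1 powr_half_square[of "sqrt (C * (p - 1) * Suc k)" p] by (simp add: powr_mult)
    finally have *: "a (Suc k) powr p \<le> (D * sqrt (C * (p - 1) * real (Suc k))) powr p" .
    have "0 \<le> D * sqrt (C * (p - 1) * real (Suc k))" using D C1 p by (intro mult_nonneg_nonneg real_sqrt_ge_zero) auto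
    then show ?thesis using p by (intro powr_le_powr_imp_le[OF *]) linarith+
  qed
qed (simp add: a0)

text \<open>Iterates \<open>greedy_step\<close>; up to sign, \<open>E k\<close> is \<open>k\<close>
  times the error of the average. Only the norms \<open>a k\<close> are passed on, so the rates
  reduce to scalar recurrences. \<open>K\<close> may depend on the current norm, as the bound for
  \<open>p >= 2\<close> requires.\<close>

lemma ex_greedy_sequence:
  fixes X :: "nat \<Rightarrow> complex mat" and w :: "nat \<Rightarrow> real" and n :: nat
  defines "A \<equiv> (\<lambda>r c. \<Sum>i<n. complex_of_real (w i) * (X i $$ (r, c)))"
  defines "Y \<equiv> (\<lambda>i r c. X i $$ (r, c) - A r c)"
  assumes w: "\<And>i. i < n \<Longrightarrow> 0 \<le> w i" "(\<Sum>i<n. w i) = 1" and p: "p \<ge> 1"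
    and D: "\<And>i. i < n \<Longrightarrow> pnorm p d (Y i) \<le> D"
    and K: "\<And>E i. i < n \<Longrightarrow> pnorm p d (\<lambda>r c. E r c + Y i r c) powr p + pnorm p d (\<lambda>r c. E r c - Y i r c) powr p
      \<le> 2 * pnorm p d E powr p + K (pnorm p d E)"
  shows "\<exists>(f :: nat \<Rightarrow> nat) a. (\<forall>k. f k < n) \<and> a 0 = 0 \<and> (\<forall>k. 0 \<le> a k) \<and> (\<forall>k. a (Suc k) \<le> a k + D) \<and>
    (\<forall>k. a (Suc k) powr p \<le> a k powr p + K (a k)) \<and>
    (\<forall>k\<ge>1. schatten_norm p (mat d d (\<lambda>(r, c). A r c) - mat_avg d (\<lambda>i. X (f i)) k) \<le> a k / real k)"
proof -
  have Y0: "(\<Sum>i<n. of_real (w i) * Y i r c) = 0" for r c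
    using w(2) by (simp add: Y_def right_diff_distrib sum_subtractf A_def flip: sum_distrib_right of_real_sum)
  have "\<exists>i<n. pnorm p d (\<lambda>r c. E r c + Y i r c) powr p \<le> pnorm p d E powr p + K (pnorm p d E)" for E
    by (rule greedy_step[OF w p Y0 K])
  then obtain g where g: "\<And>E. g E < n"
    "\<And>E. pnorm p d (\<lambda>r c. E r c + Y (g E) r c) powr p \<le> pnorm p d E powr p + K (pnorm p d E)"
    by metis
  define E where "E = rec_nat (\<lambda>r c. 0) (\<lambda>_ E r c. E r c + Y (g E) r c)"
  have E0: "E 0 = (\<lambda>r c. 0)" and ES: "E (Suc k) = (\<lambda>r c. E k r c + Y (g (E k)) r c)" for k
    by (simp_all add: E_def)
  \<comment> \<open>Averages start at index 1, so the term with index \<open>i\<close> is chosen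
    from the error after \<open>i - 1\<close> terms.\<close>
  define f where "f = (\<lambda>i. g (E (i - 1)))"
  have E_sum: "E k r c = (\<Sum>i\<in>{1..k}. X (f i) $$ (r, c)) - of_nat k * A r c" for k r c
    by (induction k) (simp_all add: E0 ES f_def Y_def algebra_simps)
  have "schatten_norm p (mat d d (\<lambda>(r, c). A r c) - mat_avg d (\<lambda>i. X (f i)) k) \<le> pnorm p d (E k) / real k"
    if k: "k \<ge> 1" for k
  proof -
    have "schatten_norm p (mat d d (\<lambda>(r, c). A r c) - mat_avg d (\<lambda>i. X (f i)) k)
        = pnorm p d (\<lambda>r c. of_real (- 1 / real k) * E k r c)"
      unfolding pnorm_def
    proof (intro arg_cong[where f = "schatten_norm p"] eq_matI)
      fix r c
      assume "r < dim_row (mat d d (\<lambda>(r, c). complex_of_real (- 1 / real k) * E k r c))"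
        "c < dim_col (mat d d (\<lambda>(r, c). complex_of_real (- 1 / real k) * E k r c))"
      then have rc: "r < d" "c < d" by auto
      then have "(mat d d (\<lambda>(r, c). A r c) - mat_avg d (\<lambda>i. X (f i)) k) $$ (r, c)
          = A r c - 1 / of_nat k * (\<Sum>i\<in>{1..k}. X (f i) $$ (r, c))" by (simp add: mat_avg_def)
      also have "\<dots> = of_real (- 1 / real k) * E k r c"
        using k unfolding E_sum by (simp add: field_simps)
      finally show "(mat d d (\<lambda>(r, c). A r c) - mat_avg d (\<lambda>i. X (f i)) k) $$ (r, c)
          = mat d d (\<lambda>(r, c). complex_of_real (- 1 / real k) * E k r c) $$ (r, c)" using rc by simp
    qed (simp_all add: mat_avg_def)
    also have "\<dots> \<le> cmod (of_real (- 1 / real k)) * pnorm p d (E k)" by (rule pnorm_scale_le[OF p])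
    also have "\<dots> = pnorm p d (E k) / real k" unfolding norm_of_real by simp
    finally show ?thesis .
  qed
  moreover have "pnorm p d (E (Suc k)) \<le> pnorm p d (E k) + D" for k
    using pnorm_add_le[OF p, of d "E k" "Y (g (E k))"] D[OF g(1)[of "E k"]] by (simp add: ES)
  ultimately show ?thesis
    using g pnorm_zero[OF p, of d]
    by (intro exI[of _ f] exI[of _ "\<lambda>k. pnorm p d (E k)"]) (simp add: E0 ES f_def)
qed

theorem mainTheorem2:
  fixes d :: nat and p :: real and S :: "complex mat set" and A :: "complex mat"
  assumes hp: "(1 < p \<and> p \<le> 4/3) \<or> p = 2 \<or> 4 \<le> p"
    and hS: "S \<subseteq> carrier_mat d d"
    and hbdd: "\<exists>M. \<forall>X\<in>S. schatten_norm p X \<le> M"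
    and hA: "A \<in> mat_conv d S"
  shows "\<exists>X :: nat \<Rightarrow> complex mat. (\<forall>i\<ge>1. X i \<in> S) \<and>
    (\<forall>k::nat. k \<ge> 1 \<longrightarrow>
      ((1 < p \<and> p \<le> 4/3) \<longrightarrow>
         schatten_norm p (A - mat_avg d X k)
           \<le> 2 * exp 2 / p powr (1 / p) * real k powr (1 / p - 1) * schatten_diam p S) \<and>
      ((p = 2 \<or> 4 \<le> p) \<longrightarrow>
         schatten_norm p (A - mat_avg d X k)
           \<le> exp 2 * sqrt (2 * (p - 1) / real k) * schatten_diam p S))"
proof -
  have p: "p \<ge> 1" using hp by auto
  define D where "D = schatten_diam p S"
  obtain n X and w :: "nat \<Rightarrow> real" where X: "\<And>i. i < n \<Longrightarrow> X i \<in> S" and w: "\<And>i. i < n \<Longrightarrow> 0 \<le> w i" "(\<Sum>i<n. w i) = 1"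
    and A: "A = mat d d (\<lambda>(r, c). \<Sum>i<n. complex_of_real (w i) * (X i $$ (r, c)))"
    using hA unfolding mat_conv_def by auto
  have diff: "pnorm p d (\<lambda>r c. X i $$ (r, c) - X j $$ (r, c)) \<le> D" if "i < n" "j < n" for i j
    using schatten_norm_diff_le_diam[OF hS hbdd p X[OF that(1)] X[OF that(2)]]
      schatten_norm_diff_eq_pnorm[OF subsetD[OF hS X[OF that(1)]] subsetD[OF hS X[OF that(2)]]] by (simp add: D_def)
  have "n > 0" using w(2) by (cases n) auto
  then have D0: "D \<ge> 0" using diff[of 0 0] pnorm_nonneg[of p d "\<lambda>r c. X 0 $$ (r, c) - X 0 $$ (r, c)"] by linarith
  define B where "B = (\<lambda>r c. \<Sum>i<n. complex_of_real (w i) * (X i $$ (r, c)))"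
  \<comment> \<open>\<open>X i - B\<close> is a convex combination of the differences
    \<open>X i - X j\<close>.\<close>
  have YD: "pnorm p d (\<lambda>r c. X i $$ (r, c) - B r c) \<le> D" if "i < n" for i
  proof -
    have "pnorm p d (\<lambda>r c. X i $$ (r, c) - B r c)
        = pnorm p d (\<lambda>r c. \<Sum>j<n. of_real (w j) * (X i $$ (r, c) - X j $$ (r, c)))"
      using w(2) by (intro pnorm_cong)
        (simp add: B_def right_diff_distrib sum_subtractf flip: sum_distrib_right of_real_sum)
    also have "\<dots> powr p \<le> (\<Sum>j<n. w j * pnorm p d (\<lambda>r c. X i $$ (r, c) - X j $$ (r, c)) powr p)"
      by (rule pnorm_powr_convex) (use w p in auto)
    also have "\<dots> \<le> (\<Sum>j<n. w j * D powr p)"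
      using w(1) diff[OF that] p by (intro sum_mono mult_left_mono powr_mono2) auto
    also have "\<dots> = D powr p" using w(2) by (simp flip: sum_distrib_right)
    finally show ?thesis by (rule powr_le_powr_imp_le) (use p D0 in auto)
  qed
  show ?thesis
  \<comment> \<open>Beyond the first range the hypothesis leaves \<open>p >= 2\<close>, so the other
    two ranges are treated together.\<close>
  proof (cases "p \<le> 4/3")
    case True
    then have p1: "1 < p" "p \<le> 2" using hp by auto
    have "pnorm p d (\<lambda>r c. E r c + (X i $$ (r, c) - B r c)) powr p + pnorm p d (\<lambda>r c. E r c - (X i $$ (r, c) - B r c)) powr p
        \<le> 2 * pnorm p d E powr p + 2 * D powr p" if "i < n" for E i
      using pnorm_Clarkson[of p d E "\<lambda>r c. X i $$ (r, c) - B r c"] p1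
        powr_mono2[OF _ pnorm_nonneg YD[OF that], of p] by simp
    from ex_greedy_sequence[where K = "\<lambda>_. 2 * D powr p", OF w p YD[unfolded B_def] this[unfolded B_def]]
    obtain f a where f: "\<And>k. f k < n" and a: "a 0 = 0" "\<And>k. 0 \<le> a k" "\<And>k. a (Suc k) powr p \<le> a k powr p + 2 * D powr p"
      "\<And>k. k \<ge> 1 \<Longrightarrow> schatten_norm p (A - mat_avg d (\<lambda>i. X (f i)) k) \<le> a k / real k"
      unfolding A by blast
    have "a k powr p \<le> 2 * real k * D powr p" for k
    proof (induction k)
      case (Suc k)
      then show ?case using a(3)[of k] by (simp add: algebra_simps)
    qed (simp add: a)
    moreover have "((2 * real k) powr (1 / p) * D) powr p = 2 * real k * D powr p" for k
      using p1 D0 by (simp add: powr_mult powr_powr)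
    ultimately have ak: "a k \<le> (2 * real k) powr (1 / p) * D" for k
      using p1 D0 by (intro powr_le_powr_imp_le[of "a k" p]) auto
    have "schatten_norm p (A - mat_avg d (\<lambda>i. X (f i)) k)
        \<le> 2 * exp 2 / p powr (1 / p) * real k powr (1 / p - 1) * D" if k: "k \<ge> 1" for k
    proof -
      \<comment> \<open>The recurrence yields the constant \<open>2 powr (1 / p)\<close>. It is
        below the claimed one because
        \<open>(2 * p) powr (1 / p) <= 2 * p <= 2 * exp 2\<close>.\<close>
      have "p powr (1 / p) * 2 powr (1 / p) = (2 * p) powr (1 / p)" by (simp add: powr_mult mult.commute)
      also have "\<dots> \<le> (2 * p) powr 1" using p1 by (intro powr_mono) auto
      also have "\<dots> \<le> 2 * exp 2" using p1 exp_ge_add_one_self[of 2] by simp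
      finally have c: "2 powr (1 / p) \<le> 2 * exp 2 / p powr (1 / p)" using p1 by (simp add: field_simps)
      have "schatten_norm p (A - mat_avg d (\<lambda>i. X (f i)) k) \<le> a k / real k" by (rule a(4)[OF k])
      also have "\<dots> \<le> (2 * real k) powr (1 / p) * D / real k" using ak by (intro divide_right_mono) auto
      also have "\<dots> = 2 powr (1 / p) * (real k powr (1 / p - 1) * D)"
        using k by (simp add: powr_mult powr_diff)
      also have "\<dots> \<le> 2 * exp 2 / p powr (1 / p) * (real k powr (1 / p - 1) * D)"
        using c D0 by (intro mult_right_mono) auto
      finally show ?thesis by (simp only: mult.assoc)
    qed
    then show ?thesis using True X f by (intro exI[of _ "\<lambda>i. X (f i)"]) (simp add: D_def)
  next
    case False
    then have p2: "p \<ge> 2" using hp by auto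
    have "pnorm p d (\<lambda>r c. E r c + (X i $$ (r, c) - B r c)) powr p + pnorm p d (\<lambda>r c. E r c - (X i $$ (r, c) - B r c)) powr p
        \<le> 2 * pnorm p d E powr p + 4 * p * (p - 1) * ((pnorm p d E + D) powr (p - 2) * D\<^sup>2)" if i: "i < n" for E i
    proof -
      let ?Y = "\<lambda>r c. X i $$ (r, c) - B r c"
      have le: "pnorm p d (\<lambda>r c. E r c + ?Y r c) \<le> pnorm p d E + D" "pnorm p d (\<lambda>r c. E r c - ?Y r c) \<le> pnorm p d E + D"
        using pnorm_add_le[OF p, of d E ?Y] pnorm_diff_le[OF p, of d E ?Y] YD[OF i] by linarith+
      have "2 * p * (p - 1) * ((pnorm p d (\<lambda>r c. E r c + ?Y r c) powr (p - 2) + pnorm p d (\<lambda>r c. E r c - ?Y r c) powr (p - 2)) * (pnorm p d ?Y)\<^sup>2)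
          \<le> 2 * p * (p - 1) * (((pnorm p d E + D) powr (p - 2) + (pnorm p d E + D) powr (p - 2)) * D\<^sup>2)"
        using p2 le YD[OF i] by (intro mult_left_mono mult_mono add_mono powr_mono2 power_mono) auto
      also have "\<dots> = 4 * p * (p - 1) * ((pnorm p d E + D) powr (p - 2) * D\<^sup>2)" by simp
      finally show ?thesis using pnorm_smoothness[OF p2, of d E ?Y] by linarith
    qed
    from ex_greedy_sequence[where K = "\<lambda>x. 4 * p * (p - 1) * ((x + D) powr (p - 2) * D\<^sup>2)", OF w p YD[unfolded B_def] this[unfolded B_def]]
    obtain f a where f: "\<And>k. f k < n" and a: "a 0 = 0" "\<And>k. 0 \<le> a k" "\<And>k. a (Suc k) \<le> a k + D"
      "\<And>k. a (Suc k) powr p \<le> a k powr p + 4 * p * (p - 1) * ((a k + D) powr (p - 2) * D\<^sup>2)"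
      "\<And>k. k \<ge> 1 \<Longrightarrow> schatten_norm p (A - mat_avg d (\<lambda>i. X (f i)) k) \<le> a k / real k"
      unfolding A by blast
    \<comment> \<open>With \<open>C = 2 * exp 4\<close> the bound of \<open>smooth_growth\<close>,
      divided by \<open>k\<close>, is exactly the claimed one; \<open>exp 3 >= 4\<close> makes this
      \<open>C\<close> admissible.\<close>
    have "exp 4 = exp 3 * exp (1::real)" by (simp flip: exp_add)
    moreover have "4 * exp (1::real) \<le> exp 3 * exp 1" using exp_ge_add_one_self[of "3::real"] by (intro mult_right_mono) auto
    ultimately have C: "2 * exp 4 \<ge> 8 * exp (1::real)" by linarith
    have "schatten_norm p (A - mat_avg d (\<lambda>i. X (f i)) k) \<le> exp 2 * sqrt (2 * (p - 1) / real k) * D" if k: "k \<ge> 1" for k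
    proof -
      have "schatten_norm p (A - mat_avg d (\<lambda>i. X (f i)) k) \<le> a k / real k" by (rule a(5)[OF k])
      also have "\<dots> \<le> D * sqrt (2 * exp 4 * (p - 1) * k) / real k"
        using smooth_growth[OF p2 D0 a(1-4) C] by (intro divide_right_mono) auto
      also have "sqrt (2 * exp 4 * (p - 1) * k) = sqrt ((exp 2 * real k)\<^sup>2 * (2 * (p - 1) / real k))"
      proof (rule arg_cong[where f = sqrt])
        have "exp 4 = (exp (2::real))\<^sup>2" by (simp add: power2_eq_square flip: exp_add)
        then show "2 * exp 4 * (p - 1) * k = (exp 2 * real k)\<^sup>2 * (2 * (p - 1) / real k)"
          using k by (simp add: power2_eq_square field_simps)
      qed
      also have "\<dots> = exp 2 * real k * sqrt (2 * (p - 1) / real k)"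
        by (simp only: real_sqrt_mult real_sqrt_abs abs_mult abs_exp_cancel abs_of_nat)
      also have "D * (exp 2 * real k * sqrt (2 * (p - 1) / real k)) / real k = exp 2 * sqrt (2 * (p - 1) / real k) * D"
        using k by simp
      finally show ?thesis .
    qed
    then show ?thesis using False X f by (intro exI[of _ "\<lambda>i. X (f i)"]) (simp add: D_def)
  qed
qed

end
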